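(* Let $n\ge1$. The standard monomials $R_{1,a_1}R_{2,a_2}\cdots R_{n-1,a_{n-1}}$, where $0 \le a_i\le i$ for $1 \le i \le n-1$, form a basis of the $\mathbb{C}(q)$-vector space $\mathcal{H}_n^-$. Also, $\dim \mathcal{H}_n^- =n!$.
   Context: Let $q$ be a formal parameter and $\varepsilon=q-q^{-1}$. The spin Hecke algebra $\mathcal{H}_n^-$ is the unital associative $\mathbb{C}(q)$-algebra generated by $R_i$ $(1\le i\le n-1)$ subject to: $R_i^2=-\varepsilon^2-2$; $R_iR_j=-R_jR_i$ for $|i-j|>1$; $R_iR_{i+1}R_i-R_{i+1}R_iR_{i+1}=\varepsilon^2(R_{i+1}-R_i)$. For $1\le i\le n-1$ and $0\le a\le i$ put $R_{i,a}:=R_iR_{i-1}\cdots R_{i-a+1}$ (a product of $a$ generators), with $R_{i,0}=1$. Dimension is over $\mathbb{C}(q)$. *)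

theory Defs
  imports
    "HOL-Library.Poly_Mapping"
    "HOL-Computational_Algebra.Fraction_Field"
    "HOL-Algebra.QuotRing"
    "Jordan_Normal_Form.VS_Connect"
begin

type_synonym ratfun = "complex poly fract"

abbreviation ratfun_field :: "ratfun ring" where
  "ratfun_field \<equiv> class_ring"

definition qparam :: ratfun where
  "qparam = Fract [:0, 1:] 1"

definition eps :: ratfun where
  "eps = qparam - inverse qparam"

text \<open>Words under concatenation, written additively, so that the convolution product of
  \<open>HOL-Library.Poly_Mapping\<close> on finitely supported functions on words is the product of the
  free associative algebra; only the letters \<open>1, \<dots>, n - 1\<close> are used.\<close>

datatype word = Word (letters: "nat list")

instantiation word :: monoid_add
begin

definition zero_word :: word where
  "0 = Word []"

definition plus_word :: "word \<Rightarrow> word \<Rightarrow> word" where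
  "v + w = Word (letters v @ letters w)"

instance
  by standard (simp_all add: zero_word_def plus_word_def)

end

definition free_gen :: "nat \<Rightarrow> word \<Rightarrow>\<^sub>0 ratfun" where
  "free_gen i = Poly_Mapping.single (Word [i]) 1"

definition free_const :: "ratfun \<Rightarrow> word \<Rightarrow>\<^sub>0 ratfun" where
  "free_const c = Poly_Mapping.single 0 c"

definition free_alg :: "nat \<Rightarrow> (word \<Rightarrow>\<^sub>0 ratfun) ring" where
  "free_alg n =
     \<lparr>carrier = {f. \<forall>w \<in> Poly_Mapping.keys f. set (letters w) \<subseteq> {1..<n}},
      mult = (*), one = 1, zero = 0, add = (+)\<rparr>"

definition spin_relators :: "nat \<Rightarrow> (word \<Rightarrow>\<^sub>0 ratfun) set" where
  "spin_relators n =
     {free_gen i ^ 2 - free_const (- (eps ^ 2) - 2) | i. i \<in> {1..<n}}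
   \<union> {free_gen i * free_gen j + free_gen j * free_gen i
        | i j. i \<in> {1..<n} \<and> j \<in> {1..<n} \<and> \<bar>int i - int j\<bar> > 1}
   \<union> {free_gen i * free_gen (i + 1) * free_gen i
        - free_gen (i + 1) * free_gen i * free_gen (i + 1)
        - free_const (eps ^ 2) * (free_gen (i + 1) - free_gen i)
        | i. i \<in> {1..<n} \<and> i + 1 \<in> {1..<n}}"

definition spin_ideal :: "nat \<Rightarrow> (word \<Rightarrow>\<^sub>0 ratfun) set" where
  "spin_ideal n = Idl\<^bsub>free_alg n\<^esub> (spin_relators n)"

text \<open>The quotient of the free algebra by the two-sided ideal of relations. Scalars act by
  multiplication with the class of the corresponding constant; the ring operations of the
  \<open>module\<close> record are those of the quotient ring.\<close>

definition spin_hecke :: "nat \<Rightarrow> (ratfun, (word \<Rightarrow>\<^sub>0 ratfun) set) module" where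
  "spin_hecke n =
     ring.extend (free_alg n Quot spin_ideal n)
       \<lparr>smult = (\<lambda>c x. (spin_ideal n +>\<^bsub>free_alg n\<^esub> free_const c)
                        \<otimes>\<^bsub>free_alg n Quot spin_ideal n\<^esub> x)\<rparr>"

definition spin_gen :: "nat \<Rightarrow> nat \<Rightarrow> (word \<Rightarrow>\<^sub>0 ratfun) set" where
  "spin_gen n i = spin_ideal n +>\<^bsub>free_alg n\<^esub> free_gen i"

definition ordered_prod :: "('a, 'b) monoid_scheme \<Rightarrow> 'a list \<Rightarrow> 'a" where
  "ordered_prod G xs = foldr (mult G) xs \<one>\<^bsub>G\<^esub>"

text \<open>Only meaningful for \<open>a \<le> i\<close>; the product has the \<open>a\<close> factors
  \<open>R\<^sub>i, R\<^sub>i\<^sub>-\<^sub>1, \<dots>, R\<^sub>i\<^sub>-\<^sub>a\<^sub>+\<^sub>1\<close> in this order.\<close>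

definition spin_block :: "nat \<Rightarrow> nat \<Rightarrow> nat \<Rightarrow> (word \<Rightarrow>\<^sub>0 ratfun) set" where
  "spin_block n i a = ordered_prod (spin_hecke n) (map (\<lambda>j. spin_gen n (i - j)) [0..<a])"

definition std_monomial :: "nat \<Rightarrow> (nat \<Rightarrow> nat) \<Rightarrow> (word \<Rightarrow>\<^sub>0 ratfun) set" where
  "std_monomial n a = ordered_prod (spin_hecke n) (map (\<lambda>i. spin_block n i (a i)) [1..<n])"

definition std_exponents :: "nat \<Rightarrow> (nat \<Rightarrow> nat) set" where
  "std_exponents n = (\<Pi>\<^sub>E i\<in>{1..<n}. {0..i})"

lemma free_alg_ring: "ring (free_alg n)"
proof (rule ringI)
  show "abelian_group (free_alg n)"
  proof (rule abelian_groupI)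
    fix x assume x: "x \<in> carrier (free_alg n)"
    then have "- x \<in> carrier (free_alg n)"
      by (simp add: free_alg_def)
    then show "\<exists>y\<in>carrier (free_alg n). y \<oplus>\<^bsub>free_alg n\<^esub> x = \<zero>\<^bsub>free_alg n\<^esub>"
      by (intro bexI[of _ "- x"]) (auto simp: free_alg_def)
  next
    fix x y assume "x \<in> carrier (free_alg n)" "y \<in> carrier (free_alg n)"
    then show "x \<oplus>\<^bsub>free_alg n\<^esub> y \<in> carrier (free_alg n)"
      using Poly_Mapping.keys_add[of x y] by (fastforce simp: free_alg_def)
  qed (auto simp: free_alg_def ac_simps)
  show "Group.monoid (free_alg n)"
  proof (rule monoidI)
    fix x y assume "x \<in> carrier (free_alg n)" "y \<in> carrier (free_alg n)"
    then show "x \<otimes>\<^bsub>free_alg n\<^esub> y \<in> carrier (free_alg n)"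
      using keys_mult[of x y] by (fastforce simp: free_alg_def plus_word_def)
  next
    show "\<one>\<^bsub>free_alg n\<^esub> \<in> carrier (free_alg n)"
      by (simp add: free_alg_def zero_word_def)
  qed (auto simp: free_alg_def ac_simps)
qed (auto simp: free_alg_def algebra_simps)

lemma free_const_carrier: "free_const c \<in> carrier (free_alg n)"
  by (simp add: free_const_def free_alg_def zero_word_def)

lemma free_gen_carrier: "i \<in> {1..<n} \<Longrightarrow> free_gen i \<in> carrier (free_alg n)"
  by (simp add: free_gen_def free_alg_def)

lemma free_alg_closed:
  assumes "x \<in> carrier (free_alg n)" "y \<in> carrier (free_alg n)"
  shows "x + y \<in> carrier (free_alg n)" "x - y \<in> carrier (free_alg n)"
    "x * y \<in> carrier (free_alg n)"
  using assms ring.ring_simprules(1,5)[OF free_alg_ring, of x n y]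
    keys_diff[of x y]
  by (simp_all add: free_alg_def) blast

lemma spin_relators_carrier: "spin_relators n \<subseteq> carrier (free_alg n)"
  by (auto simp: spin_relators_def power2_eq_square
      intro!: free_alg_closed free_const_carrier free_gen_carrier)

lemma spin_ideal_ideal: "ideal (spin_ideal n) (free_alg n)"
  unfolding spin_ideal_def
  by (rule ring.genideal_ideal[OF free_alg_ring spin_relators_carrier])

lemma spin_hecke_sel:
  "carrier (spin_hecke n) = carrier (free_alg n Quot spin_ideal n)"
  "mult (spin_hecke n) = mult (free_alg n Quot spin_ideal n)"
  "one (spin_hecke n) = one (free_alg n Quot spin_ideal n)"
  "zero (spin_hecke n) = zero (free_alg n Quot spin_ideal n)"
  "add (spin_hecke n) = add (free_alg n Quot spin_ideal n)"
  "smult (spin_hecke n) = (\<lambda>c x. (spin_ideal n +>\<^bsub>free_alg n\<^esub> free_const c)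
     \<otimes>\<^bsub>free_alg n Quot spin_ideal n\<^esub> x)"
  by (simp_all add: spin_hecke_def ring.defs)

lemma spin_hecke_ring: "ring (spin_hecke n)"
proof -
  interpret Q: ring "free_alg n Quot spin_ideal n"
    by (rule ideal.quotient_is_ring[OF spin_ideal_ideal])
  show ?thesis
  proof (rule ringI)
    show "abelian_group (spin_hecke n)"
    proof (rule abelian_groupI)
      fix x assume "x \<in> carrier (spin_hecke n)"
      then show "\<exists>y\<in>carrier (spin_hecke n). y \<oplus>\<^bsub>spin_hecke n\<^esub> x = \<zero>\<^bsub>spin_hecke n\<^esub>"
        using Q.a_inv_closed Q.l_neg by (auto simp: spin_hecke_sel)
    qed (auto simp: spin_hecke_sel Q.a_ac)
    show "Group.monoid (spin_hecke n)"
      by (rule monoidI) (auto simp: spin_hecke_sel Q.m_assoc)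
  qed (auto simp: spin_hecke_sel Q.l_distr Q.r_distr)
qed

lemma spin_hecke_vectorspace: "vectorspace ratfun_field (spin_hecke n)"
proof -
  interpret H: ring "spin_hecke n" by (rule spin_hecke_ring)
  interpret ideal "spin_ideal n" "free_alg n" by (rule spin_ideal_ideal)
  let ?h = "\<lambda>c. spin_ideal n +>\<^bsub>free_alg n\<^esub> free_const c"
  have hom: "(+>\<^bsub>free_alg n\<^esub>) (spin_ideal n) \<in> Ring.ring_hom (free_alg n) (spin_hecke n)"
    using rcos_ring_hom by (simp add: Ring.ring_hom_def spin_hecke_sel)
  have sm: "smult (spin_hecke n) = (\<lambda>c x. ?h c \<otimes>\<^bsub>spin_hecke n\<^esub> x)"
    by (simp add: spin_hecke_sel)
  have closed: "?h c \<in> carrier (spin_hecke n)" for c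
    by (rule ring_hom_closed[OF hom free_const_carrier])
  have add: "?h (c + d) = ?h c \<oplus>\<^bsub>spin_hecke n\<^esub> ?h d" for c d
    using ring_hom_add[OF hom free_const_carrier free_const_carrier, of c d]
    by (simp add: free_alg_def free_const_def single_add)
  have mult: "?h (c * d) = ?h c \<otimes>\<^bsub>spin_hecke n\<^esub> ?h d" for c d
    using ring_hom_mult[OF hom free_const_carrier free_const_carrier, of c d]
    by (simp add: free_alg_def free_const_def mult_single)
  have one: "?h 1 = \<one>\<^bsub>spin_hecke n\<^esub>"
    using ring_hom_one[OF hom] by (simp add: free_alg_def free_const_def)
  have "module ratfun_field (spin_hecke n)"
    by (rule moduleI)
      (auto simp: sm add mult one closed class_cring.cring_axioms H.abelian_group_axioms
        H.l_distr H.r_distr H.m_assoc)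
  then show ?thesis
    by (intro vectorspace.intro class_field.field_axioms)
qed

end

theory Submission
  imports Defs "HOL-Library.Function_Algebras"
begin

text \<open>
  Write \<open>D(i,t)\<close> for the descending product \<open>R\<^sub>i R\<^sub>i\<^sub>-\<^sub>1 \<dots> R\<^sub>t\<^sub>+\<^sub>1\<close>, so that the factor with
  exponent \<open>a\<close> in a standard monomial is \<open>D(i, i - a)\<close>, and \<open>H\<^sub>m\<close> for the algebra on
  \<open>R\<^sub>1, \<dots>, R\<^sub>m\<^sub>-\<^sub>1\<close>. Everything rests on the formula for the product of \<open>D(m,t)\<close> with a
  generator \<open>R\<^sub>j\<close>, \<open>j \<le> m\<close>: it equals \<open>\<plusminus> R\<^sub>j D(m,t)\<close> for \<open>j < t\<close>, it equals \<open>D(m,t-1)\<close> for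
  \<open>j = t\<close> and a scalar times \<open>D(m,t+1)\<close> for \<open>j = t+1\<close>, and for \<open>j = i+2\<close> with \<open>i \<ge> t\<close> it is
  \<open>\<plusminus> R\<^sub>i\<^sub>+\<^sub>1 D(m,t) \<plusminus> \<epsilon>\<^sup>2 D(i,t) D(m,i+1) \<plusminus> \<epsilon>\<^sup>2 D(i+1,t) D(m,i+2)\<close> (lemma \<open>desc_mult_gen\<close>). In
  every case the result is a combination of elements \<open>h D(m,s)\<close> with \<open>h \<in> H\<^sub>m\<close>.

  Read as a rewriting rule, the formula shows that \<open>\<Sum>\<^sub>t H\<^sub>m D(m,t)\<close> is stable under right
  multiplication by the generators of \<open>H\<^sub>m\<^sub>+\<^sub>1\<close>, hence is all of \<open>H\<^sub>m\<^sub>+\<^sub>1\<close>, and by induction the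
  standard monomials span.

  Read as a definition, the formula makes a right \<open>H\<^sub>m\<^sub>+\<^sub>1\<close>-module out of a right \<open>H\<^sub>m\<close>-module \<open>M\<close>:
  the underlying space is a sum of \<open>m + 1\<close> copies \<open>M e\<^sub>t\<close> of \<open>M\<close>, with \<open>e\<^sub>t\<close> in the role of
  \<open>D(m,t)\<close>. That the defining relations hold (\<open>lift_square\<close>, \<open>lift_swap\<close>, \<open>lift_braid\<close>) follows
  from the relations in \<open>M\<close>, so the construction can be repeated. Starting
  from a one-dimensional space and iterating \<open>n\<close> times gives a module with basis the lists
  \<open>[t\<^sub>n\<^sub>-\<^sub>1, \<dots>, t\<^sub>0]\<close>, \<open>t\<^sub>i \<le> i\<close>. The standard monomial with exponents \<open>a\<close> sends the basis vector
  \<open>[n-1, \<dots>, 0]\<close> to the basis vector with \<open>t\<^sub>i = i - a\<^sub>i\<close> (\<open>tower_std_word\<close>), so different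
  standard monomials have linearly independent images. Counting exponents gives \<open>n!\<close>.
\<close>

section \<open>Congruence modulo the relations\<close>

abbreviation wterm :: "ratfun \<Rightarrow> nat list \<Rightarrow> (word \<Rightarrow>\<^sub>0 ratfun)" where
  "wterm a w \<equiv> Poly_Mapping.single (Word w) a"

lemma wterm_mult: "wterm a u * wterm b v = wterm (a * b) (u @ v)"
  by (simp add: mult_single plus_word_def)

lemma wterm_carrier: "set w \<subseteq> {1..<n} \<Longrightarrow> wterm a w \<in> carrier (free_alg n)"
  by (simp add: free_alg_def)

lemma spin_ideal_add: "f \<in> spin_ideal n \<Longrightarrow> g \<in> spin_ideal n \<Longrightarrow> f + g \<in> spin_ideal n"
  using additive_subgroup.a_closed[OF ideal.axioms(1)[OF spin_ideal_ideal]]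
  by (simp add: free_alg_def)

lemma spin_ideal_mult:
  assumes "f \<in> spin_ideal n" "g \<in> carrier (free_alg n)"
  shows "g * f \<in> spin_ideal n" "f * g \<in> spin_ideal n"
  using assms ideal.I_l_closed[OF spin_ideal_ideal] ideal.I_r_closed[OF spin_ideal_ideal]
  by (simp_all add: free_alg_def)

lemma spin_ideal_zero: "0 \<in> spin_ideal n"
  using additive_subgroup.zero_closed[OF ideal.axioms(1)[OF spin_ideal_ideal]]
  by (simp add: free_alg_def)

lemma spin_ideal_uminus: "f \<in> spin_ideal n \<Longrightarrow> - f \<in> spin_ideal n"
  using spin_ideal_mult(1)[OF _ free_const_carrier[of "-1" n], of f]
  by (simp add: free_const_def single_uminus)

lemma spin_ideal_relator: "f \<in> spin_relators n \<Longrightarrow> f \<in> spin_ideal n"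
  using ring.genideal_self[OF free_alg_ring spin_relators_carrier]
  by (auto simp: spin_ideal_def)

definition spin_cong :: "nat \<Rightarrow> (word \<Rightarrow>\<^sub>0 ratfun) \<Rightarrow> (word \<Rightarrow>\<^sub>0 ratfun) \<Rightarrow> bool" where
  "spin_cong n f g \<longleftrightarrow> f - g \<in> spin_ideal n"

lemma spin_cong_refl [simp]: "spin_cong n f f"
  by (simp add: spin_cong_def spin_ideal_zero)

lemma spin_cong_sym: "spin_cong n f g \<Longrightarrow> spin_cong n g f"
  using spin_ideal_uminus[of "f - g" n] by (simp add: spin_cong_def)

lemma spin_cong_trans [trans]: "spin_cong n f g \<Longrightarrow> spin_cong n g h \<Longrightarrow> spin_cong n f h"
  using spin_ideal_add[of "f - g" n "g - h"] by (simp add: spin_cong_def)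

lemma spin_cong_add:
  "spin_cong n f g \<Longrightarrow> spin_cong n f' g' \<Longrightarrow> spin_cong n (f + f') (g + g')"
  using spin_ideal_add[of "f - g" n "f' - g'"] by (simp add: spin_cong_def algebra_simps)

lemma spin_cong_context:
  assumes "spin_cong n f g" "set u \<subseteq> {1..<n}" "set v \<subseteq> {1..<n}"
  shows "spin_cong n (wterm a u * f * wterm b v) (wterm a u * g * wterm b v)"
proof -
  have "wterm a u * (f - g) * wterm b v \<in> spin_ideal n"
    using assms
    by (intro spin_ideal_mult(2) spin_ideal_mult(1) wterm_carrier) (simp_all add: spin_cong_def)
  then show ?thesis by (simp add: spin_cong_def algebra_simps)
qed

lemma spin_cong_square:
  assumes "set (u @ v) \<subseteq> {1..<n}" "i \<in> {1..<n}"
  shows "spin_cong n (wterm a (u @ [i, i] @ v)) (wterm (a * (- (eps ^ 2) - 2)) (u @ v))"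
proof -
  have "free_gen i ^ 2 - free_const (- (eps ^ 2) - 2) \<in> spin_relators n"
    using assms(2) unfolding spin_relators_def by blast
  then have "spin_cong n (wterm 1 [i, i]) (wterm (- (eps ^ 2) - 2) [])"
    using spin_ideal_relator
    by (simp add: spin_cong_def free_gen_def free_const_def power2_eq_square wterm_mult zero_word_def)
  from spin_cong_context[OF this, of u v a 1] show ?thesis
    using assms by (simp add: wterm_mult)
qed

lemma spin_cong_swap:
  assumes "set (u @ v) \<subseteq> {1..<n}" "i \<in> {1..<n}" "j \<in> {1..<n}" "\<bar>int i - int j\<bar> > 1"
  shows "spin_cong n (wterm a (u @ [i, j] @ v)) (wterm (- a) (u @ [j, i] @ v))"
proof -
  have "free_gen i * free_gen j + free_gen j * free_gen i \<in> spin_relators n"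
    using assms(2-4) unfolding spin_relators_def by blast
  then have "spin_cong n (wterm 1 [i, j]) (wterm (- 1) [j, i])"
    using spin_ideal_relator
    by (simp add: spin_cong_def free_gen_def wterm_mult single_uminus)
  from spin_cong_context[OF this, of u v a 1] show ?thesis
    using assms by (simp add: wterm_mult)
qed

lemma spin_cong_braid:
  assumes "set (u @ v) \<subseteq> {1..<n}" "i \<in> {1..<n}" "Suc i \<in> {1..<n}"
  shows "spin_cong n (wterm a (u @ [Suc i, i, Suc i] @ v))
    (wterm a (u @ [i, Suc i, i] @ v) + wterm (- (a * eps ^ 2)) (u @ [Suc i] @ v)
      + wterm (a * eps ^ 2) (u @ [i] @ v))"
proof -
  have "free_gen i * free_gen (i + 1) * free_gen i
        - free_gen (i + 1) * free_gen i * free_gen (i + 1)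
        - free_const (eps ^ 2) * (free_gen (i + 1) - free_gen i) \<in> spin_relators n"
    using assms(2,3) unfolding spin_relators_def by auto
  then have rel: "wterm 1 [i, Suc i, i] - wterm 1 [Suc i, i, Suc i]
       - (wterm (eps^2) [Suc i] - wterm (eps^2) [i])
     \<in> spin_ideal n"
    using spin_ideal_relator
    by (force simp: free_gen_def free_const_def wterm_mult zero_word_def algebra_simps)
  have regroup: "x + - y + z - w = x - w - (y - z)" for x y z w :: "word \<Rightarrow>\<^sub>0 ratfun"
    by (simp add: algebra_simps)
  have "spin_cong n (wterm 1 [i, Suc i, i] + wterm (- (eps ^ 2)) [Suc i] + wterm (eps ^ 2) [i])
     (wterm 1 [Suc i, i, Suc i])"
    unfolding spin_cong_def single_uminus regroup by (rule rel)
  from spin_cong_context[OF this, of u v a 1]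
  have ctx: "spin_cong n (wterm a (u @ [i, Suc i, i] @ v) + wterm (- (a * eps ^ 2)) (u @ [Suc i] @ v)
      + wterm (a * eps ^ 2) (u @ [i] @ v)) (wterm a (u @ [Suc i, i, Suc i] @ v))"
    using assms by (simp add: wterm_mult distrib_left distrib_right)
  show ?thesis
    by (rule spin_cong_sym[OF ctx])
qed

lemma spin_cong_move_letter:
  assumes "set (p @ q @ w) \<subseteq> {1..<n}" "i \<in> {1..<n}" "\<forall>j\<in>set w. \<bar>int i - int j\<bar> > 1"
  shows "spin_cong n (wterm a (p @ w @ [i] @ q)) (wterm ((- 1) ^ length w * a) (p @ [i] @ w @ q))"
  using assms
proof (induction w arbitrary: p a)
  case (Cons k w)
  have "spin_cong n (wterm a ((p @ [k]) @ w @ [i] @ q))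
      (wterm ((- 1) ^ length w * a) ((p @ [k]) @ [i] @ w @ q))"
    using Cons.prems by (intro Cons.IH) auto
  also have "spin_cong n (wterm ((- 1) ^ length w * a) ((p @ [k]) @ [i] @ w @ q))
     (wterm (- ((- 1) ^ length w * a)) (p @ [i, k] @ w @ q))"
    using Cons.prems spin_cong_swap[of p "w @ q" n k i "(- 1) ^ length w * a"]
    by (auto simp: abs_minus_commute)
  finally show ?case by simp
qed simp

lemma spin_cong_move_word:
  assumes "set (p @ q @ u @ w) \<subseteq> {1..<n}" "\<forall>i\<in>set u. \<forall>j\<in>set w. \<bar>int i - int j\<bar> > 1"
  shows "spin_cong n (wterm a (p @ w @ u @ q)) (wterm ((- 1) ^ (length u * length w) * a) (p @ u @ w @ q))"
  using assms
proof (induction u arbitrary: p a)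
  case (Cons i u)
  have "spin_cong n (wterm a (p @ w @ [i] @ u @ q)) (wterm ((- 1) ^ length w * a) (p @ [i] @ w @ u @ q))"
    using Cons.prems by (intro spin_cong_move_letter) auto
  also have "spin_cong n (wterm ((- 1) ^ length w * a) (p @ [i] @ w @ u @ q))
     (wterm ((- 1) ^ (length u * length w) * ((- 1) ^ length w * a)) ((p @ [i]) @ u @ w @ q))"
    using Cons.prems Cons.IH[of "p @ [i]" "(- 1) ^ length w * a"] by auto
  finally show ?case by (simp add: power_add mult_ac)
qed simp

section \<open>Descending words\<close>

text \<open>The word of \<open>R\<^sub>i R\<^sub>i\<^sub>-\<^sub>1 \<dots> R\<^sub>t\<^sub>+\<^sub>1\<close>. Indexing by the first missing letter \<open>t\<close> instead of the
  length makes right multiplication by \<open>R\<^sub>j\<close> look like the transposition of \<open>j - 1\<close> and \<open>j\<close> acting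
  on \<open>t\<close>.\<close>
definition desc :: "nat \<Rightarrow> nat \<Rightarrow> nat list" where
  "desc i t = rev [Suc t..<Suc i]"

lemma length_desc [simp]: "length (desc i t) = i - t"
  by (simp add: desc_def del: upt_Suc)

lemma set_desc [simp]: "set (desc i t) = {t<..i}"
  by (auto simp: desc_def simp del: upt_Suc)

lemma desc_same [simp]: "desc i i = []"
  by (simp add: desc_def)

lemma desc_Suc: "t \<le> i \<Longrightarrow> desc (Suc i) t = Suc i # desc i t"
  by (simp add: desc_def)

lemma desc_snoc: "t < i \<Longrightarrow> desc i t = desc i (Suc t) @ [Suc t]"
  by (simp add: desc_def upt_conv_Cons[of "Suc t"] del: upt_Suc)

lemma desc_append: "s \<le> t \<Longrightarrow> t \<le> i \<Longrightarrow> desc i s = desc i t @ desc t s"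
proof -
  assume "s \<le> t" "t \<le> i"
  then have "[Suc s..<Suc i] = [Suc s..<Suc t] @ [Suc t..<Suc i]"
    using upt_add_eq_append[of "Suc s" "Suc t" "i - t"] by simp
  then show ?thesis by (simp add: desc_def del: upt_Suc)
qed

text \<open>\<open>R\<^sub>i\<^sub>+\<^sub>2\<close> anticommutes to the left until it meets \<open>R\<^sub>i\<^sub>+\<^sub>2 R\<^sub>i\<^sub>+\<^sub>1\<close>, where the braid relation
  applies. In the main term \<open>R\<^sub>i\<^sub>+\<^sub>1\<close> continues to the left end. Each of the two error terms lacks
  one letter, and across the gap the lower part of the word anticommutes past the upper part,
  leaving two descending words. All signs are powers of \<open>-1\<close> counting these exchanges; differences
  in the exponents are replaced by sums of the same parity.\<close>
lemma desc_mult_gen: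
  assumes "t \<le> i" "Suc (Suc i) \<le> p" "p < n"
  shows "spin_cong n (wterm 1 (desc p t @ [Suc (Suc i)]))
    (wterm ((- 1) ^ (p + t)) (Suc i # desc p t)
     + wterm (- (eps ^ 2) * (- 1) ^ ((p + i) * (i + t))) (desc i t @ desc p (Suc i))
     + wterm (eps ^ 2 * (- 1) ^ (p + t + (p + i) * (i + t))) (desc (Suc i) t @ desc p (Suc (Suc i))))"
proof -
  define j where "j = Suc (Suc i)"
  define P where "P = desc p j"
  define Q where "Q = desc i t"
  let ?s = "(- 1) ^ length Q :: ratfun"
  have split: "desc p t = P @ [j, Suc i] @ Q"
    using assms desc_append[of t j p] by (simp add: desc_Suc P_def Q_def j_def)
  have lower: "desc (Suc i) t = Suc i # Q" and upper: "desc p (Suc i) = P @ [j]"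
    using assms desc_snoc[of "Suc i" p] by (simp_all add: desc_Suc P_def Q_def j_def)
  have P: "\<And>x. x \<in> set P \<Longrightarrow> j < x \<and> x \<le> p" and Q: "\<And>x. x \<in> set Q \<Longrightarrow> 0 < x \<and> x \<le> i"
    by (auto simp: P_def Q_def)
  have sub: "set P \<subseteq> {1..<n}" "set Q \<subseteq> {1..<n}" "j \<in> {1..<n}" "Suc i \<in> {1..<n}"
    using P Q assms by (force simp: j_def)+
  have "spin_cong n (wterm 1 ((P @ [j, Suc i]) @ Q @ [j] @ []))
     (wterm (?s * 1) ((P @ [j, Suc i]) @ [j] @ Q @ []))"
  proof (rule spin_cong_move_letter)
    show "\<forall>x\<in>set Q. \<bar>int j - int x\<bar> > 1"
      using Q by (force simp: j_def)
  qed (use sub in simp_all)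
  also have "spin_cong n (wterm (?s * 1) ((P @ [j, Suc i]) @ [j] @ Q @ []))
     (wterm ?s (P @ [Suc i, j, Suc i] @ Q) + wterm (- (?s * eps ^ 2)) (P @ [j] @ Q)
      + wterm (?s * eps ^ 2) (P @ [Suc i] @ Q))"
    using spin_cong_braid[of P Q n "Suc i" ?s] sub by (simp add: j_def)
  also have "spin_cong n \<dots>
     (wterm ((- 1) ^ length P * ?s) ([] @ [Suc i] @ P @ [j, Suc i] @ Q)
      + wterm ((- 1) ^ (length Q * length (P @ [j])) * - (?s * eps ^ 2)) ([] @ Q @ (P @ [j]) @ [])
      + wterm ((- 1) ^ (length (Suc i # Q) * length P) * (?s * eps ^ 2)) ([] @ (Suc i # Q) @ P @ []))"
  proof (intro spin_cong_add)
    have "spin_cong n (wterm ?s ([] @ P @ [Suc i] @ [j, Suc i] @ Q))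
       (wterm ((- 1) ^ length P * ?s) ([] @ [Suc i] @ P @ [j, Suc i] @ Q))"
    proof (rule spin_cong_move_letter)
      show "\<forall>x\<in>set P. \<bar>int (Suc i) - int x\<bar> > 1"
        using P by (force simp: j_def)
    qed (use sub in simp_all)
    then show "spin_cong n (wterm ?s (P @ [Suc i, j, Suc i] @ Q))
       (wterm ((- 1) ^ length P * ?s) ([] @ [Suc i] @ P @ [j, Suc i] @ Q))"
      by simp
    have "spin_cong n (wterm (- (?s * eps ^ 2)) ([] @ (P @ [j]) @ Q @ []))
       (wterm ((- 1) ^ (length Q * length (P @ [j])) * - (?s * eps ^ 2)) ([] @ Q @ (P @ [j]) @ []))"
    proof (rule spin_cong_move_word)
      show "\<forall>x\<in>set Q. \<forall>y\<in>set (P @ [j]). \<bar>int x - int y\<bar> > 1"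
        using P Q by (force simp: j_def)
    qed (use sub in simp_all)
    then show "spin_cong n (wterm (- (?s * eps ^ 2)) (P @ [j] @ Q))
       (wterm ((- 1) ^ (length Q * length (P @ [j])) * - (?s * eps ^ 2)) ([] @ Q @ (P @ [j]) @ []))"
      by simp
    have "spin_cong n (wterm (?s * eps ^ 2) ([] @ P @ (Suc i # Q) @ []))
       (wterm ((- 1) ^ (length (Suc i # Q) * length P) * (?s * eps ^ 2)) ([] @ (Suc i # Q) @ P @ []))"
    proof (rule spin_cong_move_word)
      show "\<forall>x\<in>set (Suc i # Q). \<forall>y\<in>set P. \<bar>int x - int y\<bar> > 1"
        using P Q by (force simp: j_def)
    qed (use sub in simp_all)
    then show "spin_cong n (wterm (?s * eps ^ 2) (P @ [Suc i] @ Q))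
       (wterm ((- 1) ^ (length (Suc i # Q) * length P) * (?s * eps ^ 2)) ([] @ (Suc i # Q) @ P @ []))"
      by simp
  qed
  finally have "spin_cong n (wterm 1 (desc p t @ [j]))
     (wterm ((- 1) ^ length P * ?s) (Suc i # desc p t)
      + wterm ((- 1) ^ (length Q * length (P @ [j])) * - (?s * eps ^ 2)) (Q @ desc p (Suc i))
      + wterm ((- 1) ^ (length (Suc i # Q) * length P) * (?s * eps ^ 2)) (desc (Suc i) t @ P))"
    by (simp add: split lower upper)
  moreover have "even (length P) \<longleftrightarrow> (even p \<longleftrightarrow> even i)" "even (length Q) \<longleftrightarrow> (even i \<longleftrightarrow> even t)"
    using assms by (auto simp: P_def Q_def j_def)
  then have "(- 1) ^ length P * ?s = (- 1) ^ (p + t)"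
    "(- 1) ^ (length Q * length (P @ [j])) * - (?s * eps ^ 2)
       = - (eps ^ 2) * (- 1) ^ ((p + i) * (i + t))"
    "(- 1) ^ (length (Suc i # Q) * length P) * (?s * eps ^ 2)
       = eps ^ 2 * (- 1) ^ (p + t + (p + i) * (i + t))"
    by (auto simp: minus_one_power_iff)
  ultimately show ?thesis
    unfolding P_def[symmetric] Q_def[symmetric] j_def[symmetric] by (simp only:)
qed

section \<open>Right modules over the spin Hecke algebra\<close>
lemma update_fresh_key:
  assumes "w \<notin> Poly_Mapping.keys f"
  shows "Poly_Mapping.update w c f = wterm c (letters w) + f"
  using assms
  by (intro poly_mapping_eqI)
    (auto simp: lookup_update lookup_add lookup_single when_def in_keys_iff)

lemma wterm_induct [case_names zero wterm add]:
  assumes "P 0" "\<And>w c. P (wterm c w)" "\<And>f g. P f \<Longrightarrow> P g \<Longrightarrow> P (f + g)"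
  shows "P f"
proof (induction f rule: update_induct)
  case (update f w c)
  from assms(3)[OF assms(2) update.IH] show ?case
    unfolding update_fresh_key[OF update.hyps(1)] .
qed (rule assms(1))

definition square_const :: ratfun where
  "square_const = - (eps ^ 2) - 2"

text \<open>A right module over the algebra on \<open>R\<^sub>1, \<dots>, R\<^sub>m\<^sub>-\<^sub>1\<close>: \<open>r x j\<close> is \<open>x \<cdot> R\<^sub>j\<close>, so that words act
  through \<open>foldl r\<close>. The relations are required on the subspace \<open>M\<close> only, while linearity holds
  everywhere. The ambient type then need not change when the module is extended, and linear
  identities can be used without side conditions.\<close>
locale spin_module = vector_space scl
  for scl :: "ratfun \<Rightarrow> 'v::ab_group_add \<Rightarrow> 'v" +
  fixes m :: nat and M :: "'v set" and r :: "'v \<Rightarrow> nat \<Rightarrow> 'v"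
  assumes gen_add: "r (x + y) j = r x j + r y j"
    and gen_scl: "r (scl a x) j = scl a (r x j)"
    and zero_mem: "0 \<in> M"
    and add_mem: "x \<in> M \<Longrightarrow> y \<in> M \<Longrightarrow> x + y \<in> M"
    and scl_mem: "x \<in> M \<Longrightarrow> scl a x \<in> M"
    and gen_mem: "x \<in> M \<Longrightarrow> 0 < j \<Longrightarrow> j < m \<Longrightarrow> r x j \<in> M"
    and gen_square: "x \<in> M \<Longrightarrow> 0 < j \<Longrightarrow> j < m \<Longrightarrow> r (r x j) j = scl square_const x"
    and gen_swap: "x \<in> M \<Longrightarrow> 0 < i \<Longrightarrow> Suc i < j \<Longrightarrow> j < m \<Longrightarrow> r (r x i) j = - r (r x j) i"
    and gen_braid: "x \<in> M \<Longrightarrow> 0 < i \<Longrightarrow> Suc i < m \<Longrightarrow>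
      r (r (r x i) (Suc i)) i - r (r (r x (Suc i)) i) (Suc i)
        = scl (eps ^ 2) (r x (Suc i) - r x i)"
begin

lemmas scl_simps = scale_right_distrib scale_left_distrib scale_right_diff_distrib
  scale_left_diff_distrib

definition act :: "(word \<Rightarrow>\<^sub>0 ratfun) \<Rightarrow> 'v \<Rightarrow> 'v" where
  "act f x = (\<Sum>w\<in>Poly_Mapping.keys f. scl (Poly_Mapping.lookup f w) (foldl r x (letters w)))"

lemma act_wterm [simp]: "act (wterm c w) x = scl c (foldl r x w)"
  by (auto simp: act_def)

lemma act_zero [simp]: "act 0 x = 0"
  by (simp add: act_def)

lemma act_add: "act (f + g) x = act f x + act g x"
proof -
  let ?S = "Poly_Mapping.keys f \<union> Poly_Mapping.keys g"
  have *: "act h x = (\<Sum>w\<in>?S. scl (Poly_Mapping.lookup h w) (foldl r x (letters w)))"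
    if "Poly_Mapping.keys h \<subseteq> ?S" for h
    unfolding act_def using that by (intro sum.mono_neutral_left) (auto simp: in_keys_iff)
  show ?thesis
    using Poly_Mapping.keys_add[of f g]
    by (simp add: * lookup_add scl_simps sum.distrib)
qed

lemma act_uminus: "act (- f) x = - act f x"
  using act_add[of f "- f" x] by (simp add: eq_neg_iff_add_eq_0 add.commute)

lemma act_diff: "act (f - g) x = act f x - act g x"
  using act_add[of f "- g" x] by (simp add: act_uminus)

lemma gen_zero [simp]: "r 0 j = 0"
  using gen_scl[of 0 0 j] by simp

lemma word_add: "foldl r (x + y) w = foldl r x w + foldl r y w"
  by (induction w arbitrary: x y) (simp_all add: gen_add)

lemma word_scl: "foldl r (scl a x) w = scl a (foldl r x w)"
  by (induction w arbitrary: x) (simp_all add: gen_scl)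

lemma gen_minus: "r (x - y) j = r x j - r y j" "r (- x) j = - r x j"
proof -
  show uminus: "r (- x) j = - r x j" for x
    using gen_scl[of "- 1" x] by simp
  show "r (x - y) j = r x j - r y j"
    using gen_add[of x "- y"] by (simp add: uminus)
qed

lemma word_minus: "foldl r (x - y) w = foldl r x w - foldl r y w" "foldl r (- x) w = - foldl r x w"
proof -
  show uminus: "foldl r (- x) w = - foldl r x w" for x
    using word_scl[of "- 1" x] by simp
  show "foldl r (x - y) w = foldl r x w - foldl r y w"
    using word_add[of x "- y"] by (simp add: uminus)
qed

lemma word_mem: "x \<in> M \<Longrightarrow> set w \<subseteq> {1..<m} \<Longrightarrow> foldl r x w \<in> M"
  by (induction w arbitrary: x) (simp_all add: gen_mem Suc_le_eq)

lemma word_zero [simp]: "foldl r 0 w = 0"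
  by (induction w) simp_all

lemma act_right_zero [simp]: "act f 0 = 0"
  by (simp add: act_def)

lemma act_add_right: "act f (x + y) = act f x + act f y"
  by (simp add: act_def word_add scl_simps sum.distrib)

lemma act_scl: "act f (scl a x) = scl a (act f x)"
  by (simp add: act_def word_scl scale_sum_right mult_ac)

lemma act_mult: "act (f * g) x = act g (act f x)"
proof (induction f rule: wterm_induct)
  case (wterm u c)
  show ?case
  proof (induction g rule: wterm_induct)
    case (wterm v d)
    show ?case by (simp add: wterm_mult word_scl mult_ac)
  qed (simp_all add: act_add distrib_left)
qed (simp_all add: act_add act_add_right distrib_right)

lemma act_mem: "x \<in> M \<Longrightarrow> f \<in> carrier (free_alg m) \<Longrightarrow> act f x \<in> M"
proof -
  assume *: "x \<in> M" "f \<in> carrier (free_alg m)"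
  have "(\<Sum>w\<in>S. scl (Poly_Mapping.lookup f w) (foldl r x (letters w))) \<in> M"
    if "S \<subseteq> Poly_Mapping.keys f" "finite S" for S
    using that(2,1) *
    by (induction S) (simp_all add: free_alg_def zero_mem add_mem scl_mem word_mem)
  then show ?thesis by (simp add: act_def)
qed

text \<open>The elements annihilating \<open>M\<close> form a two-sided ideal that contains the relators.\<close>
lemma act_spin_ideal: "f \<in> spin_ideal m \<Longrightarrow> x \<in> M \<Longrightarrow> act f x = 0"
proof -
  define N where "N = {f \<in> carrier (free_alg m). \<forall>x\<in>M. act f x = 0}"
  interpret F: ring "free_alg m" by (rule free_alg_ring)
  have uminus: "\<ominus>\<^bsub>free_alg m\<^esub> f = - f" "- f \<in> carrier (free_alg m)"
    if "f \<in> carrier (free_alg m)" for f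
  proof -
    show "- f \<in> carrier (free_alg m)" using that by (simp add: free_alg_def)
    then show "\<ominus>\<^bsub>free_alg m\<^esub> f = - f"
      using that by (intro F.minus_equality) (simp_all add: free_alg_def)
  qed
  have "ideal N (free_alg m)"
  proof (rule idealI)
    show "ring (free_alg m)" by (rule free_alg_ring)
    show "subgroup N (add_monoid (free_alg m))"
    proof (rule group.subgroupI)
      show "Group.group (add_monoid (free_alg m))" by (rule F.a_group)
      show "N \<subseteq> carrier (add_monoid (free_alg m))" by (auto simp: N_def)
      show "N \<noteq> {}" by (auto simp: N_def free_alg_def intro!: exI[of _ 0])
      show "inv\<^bsub>add_monoid (free_alg m)\<^esub> f \<in> N" if "f \<in> N" for f
        using that uminus[of f] unfolding a_inv_def by (simp add: N_def act_uminus)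
      show "f \<otimes>\<^bsub>add_monoid (free_alg m)\<^esub> g \<in> N" if "f \<in> N" "g \<in> N" for f g
        using that F.a_closed[of f g] by (simp add: N_def free_alg_def act_add)
    qed
    show "g \<otimes>\<^bsub>free_alg m\<^esub> f \<in> N" "f \<otimes>\<^bsub>free_alg m\<^esub> g \<in> N"
      if "f \<in> N" "g \<in> carrier (free_alg m)" for f g
      using that F.m_closed[of f g] F.m_closed[of g f]
      by (auto simp: N_def act_mem) (auto simp: free_alg_def act_mult act_mem)
  qed
  moreover have "spin_relators m \<subseteq> N"
  proof
    fix f assume f: "f \<in> spin_relators m"
    have "act f x = 0" if "x \<in> M" for x
      using f unfolding spin_relators_def
    proof (elim UnE CollectE exE conjE)
      fix i assume "f = free_gen i ^ 2 - free_const (- (eps ^ 2) - 2)" "i \<in> {1..<m}"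
      then show ?thesis using gen_square[OF that, of i]
        by (simp add: free_gen_def free_const_def power2_eq_square wterm_mult zero_word_def
          act_diff square_const_def)
    next
      fix i j assume "f = free_gen i * free_gen j + free_gen j * free_gen i"
        "i \<in> {1..<m}" "j \<in> {1..<m}" "\<bar>int i - int j\<bar> > 1"
      then show ?thesis using gen_swap[OF that, of i j] gen_swap[OF that, of j i]
        by (cases "i < j") (auto simp: free_gen_def wterm_mult act_add)
    next
      fix i assume "f = free_gen i * free_gen (i + 1) * free_gen i
        - free_gen (i + 1) * free_gen i * free_gen (i + 1)
        - free_const (eps ^ 2) * (free_gen (i + 1) - free_gen i)"
        "i \<in> {1..<m}" "i + 1 \<in> {1..<m}"
      then show ?thesis using gen_braid[OF that, of i]
        by (simp add: free_gen_def free_const_def zero_word_def wterm_mult act_diff right_diff_distrib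
          scl_simps)
    qed
    then show "f \<in> N" using f spin_relators_carrier by (auto simp: N_def)
  qed
  ultimately have "spin_ideal m \<subseteq> N"
    unfolding spin_ideal_def by (rule F.genideal_minimal)
  then show "f \<in> spin_ideal m \<Longrightarrow> x \<in> M \<Longrightarrow> act f x = 0"
    by (auto simp: N_def)
qed

lemma act_spin_cong: "spin_cong m f g \<Longrightarrow> x \<in> M \<Longrightarrow> act f x = act g x"
  using act_spin_ideal[of "f - g" x] by (simp add: spin_cong_def act_diff)

lemma word_move:
  assumes "x \<in> M" "set w \<subseteq> {1..<m}" "0 < i" "i < m" "\<forall>j\<in>set w. \<bar>int i - int j\<bar> > 1"
  shows "r (foldl r x w) i = scl ((- 1) ^ length w) (foldl r (r x i) w)"
  using act_spin_cong[OF spin_cong_move_letter[of "[]" "[]" w m i 1] assms(1)] assms by simp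

lemma word_desc_far:
  assumes "y \<in> M" "t \<le> p" "p < m" "0 < k" "k < m" "k < t \<or> Suc p < k"
  shows "r (foldl r y (desc p t)) k = scl ((- 1) ^ (p + t)) (foldl r (r y k) (desc p t))"
proof -
  have "set (desc p t) \<subseteq> {1..<m}" "\<forall>l\<in>set (desc p t). \<bar>int k - int l\<bar> > 1"
    using assms by auto
  then have "r (foldl r y (desc p t)) k = scl ((- 1) ^ (p - t)) (foldl r (r y k) (desc p t))"
    using word_move[OF assms(1), of "desc p t" k] assms by simp
  then show ?thesis
    using assms(2) by (simp add: minus_one_power_iff)
qed

text \<open>The relation \<open>desc_mult_gen\<close> transported to a module, where it becomes an equation.\<close>
lemma word_desc_gen:
  assumes "x \<in> M" "t \<le> i" "Suc (Suc i) \<le> p" "p < m"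
  shows "r (foldl r x (desc p t)) (Suc (Suc i)) =
     scl ((- 1) ^ (p + t)) (foldl r (r x (Suc i)) (desc p t))
     + scl (- (eps ^ 2) * (- 1) ^ ((p + i) * (i + t)))
         (foldl r (foldl r x (desc i t)) (desc p (Suc i)))
     + scl (eps ^ 2 * (- 1) ^ (p + t + (p + i) * (i + t)))
         (foldl r (foldl r x (desc (Suc i) t)) (desc p (Suc (Suc i))))"
  using act_spin_cong[OF desc_mult_gen[OF assms(2,3,4)] assms(1)]
  by (simp add: act_add)

end

section \<open>Extending a module by one generator\<close>
lemma letter_position_cases:
  obtains "j < t" | "j = t" | "j = Suc t" | i where "j = Suc (Suc i)" "t \<le> i"
proof -
  have "j = Suc (Suc (j - 2)) \<and> t \<le> j - 2" if "\<not> j < t" "j \<noteq> t" "j \<noteq> Suc t"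
    using that by auto
  with that show ?thesis by blast
qed

text \<open>\<open>cons t x\<close> is \<open>x e\<^sub>t\<close>, where \<open>e\<^sub>t\<close> stands for \<open>R\<^sub>m R\<^sub>m\<^sub>-\<^sub>1 \<dots> R\<^sub>t\<^sub>+\<^sub>1\<close>, and \<open>L\<close> is the
  right action of the generators up to \<open>R\<^sub>m\<close>. The last four assumptions are the formulas that the
  relations force on such products. Keeping both spaces abstract
  turns the verification of the relations into pure linear algebra.\<close>
locale spin_lift = spin_module scl m M r + W: vector_space scw
  for scl :: "ratfun \<Rightarrow> 'v::ab_group_add \<Rightarrow> 'v" and m M r
    and scw :: "ratfun \<Rightarrow> 'w::ab_group_add \<Rightarrow> 'w" +
  fixes cons :: "nat \<Rightarrow> 'v \<Rightarrow> 'w" and L :: "'w \<Rightarrow> nat \<Rightarrow> 'w"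
  assumes cons_add: "cons t (x + y) = cons t x + cons t y"
    and cons_scl: "cons t (scl a x) = scw a (cons t x)"
    and lift_add: "L (f + g) j = L f j + L g j"
    and lift_scw: "L (scw a f) j = scw a (L f j)"
    and lift_above: "t \<le> m \<Longrightarrow> j < t \<Longrightarrow> L (cons t x) j = scw ((- 1) ^ (m + t)) (cons t (r x j))"
    and lift_down: "Suc t \<le> m \<Longrightarrow> L (cons (Suc t) x) (Suc t) = cons t x"
    and lift_up: "t \<le> m \<Longrightarrow> L (cons t x) (Suc t) = scw square_const (cons (Suc t) x)"
    and lift_below: "t \<le> m \<Longrightarrow> t \<le> i \<Longrightarrow> L (cons t x) (Suc (Suc i)) =
        scw ((- 1) ^ (m + t)) (cons t (r x (Suc i)))
        + scw (- (eps ^ 2) * (- 1) ^ ((m + i) * (i + t))) (cons (Suc i) (foldl r x (desc i t)))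
        + scw (eps ^ 2 * (- 1) ^ (m + t + (m + i) * (i + t)))
            (cons (Suc (Suc i)) (foldl r x (desc (Suc i) t)))"
begin

lemma cons_minus: "cons t (x - y) = cons t x - cons t y" "cons t (- x) = - cons t x"
proof -
  show uminus: "cons t (- x) = - cons t x" for x
    using cons_scl[of t "- 1" x] by simp
  show "cons t (x - y) = cons t x - cons t y"
    using cons_add[of t x "- y"] by (simp add: uminus)
qed

lemma lift_minus: "L (f - g) j = L f j - L g j" "L (- f) j = - L f j"
proof -
  show uminus: "L (- f) j = - L f j" for f
    using lift_scw[of "- 1" f] by simp
  show "L (f - g) j = L f j - L g j"
    using lift_add[of f "- g"] by (simp add: uminus)
qed

lemmas linear_rules = gen_add gen_scl gen_minus word_add word_scl word_minus
  cons_add cons_scl cons_minus W.scale_right_distrib W.scale_right_diff_distrib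

lemmas lift_rules = lift_add lift_scw lift_minus lift_above lift_down lift_up lift_below

text \<open>Once the parities of \<open>m\<close>, \<open>t\<close> and the letters are fixed, every sign in the formulas below is
  known and each relation becomes a linear identity in \<open>M\<close>. For the square with \<open>j = i+2\<close>, the two
  correction terms are exchanged by the second factor (\<open>e\<^sub>i\<^sub>+\<^sub>1\<close> and \<open>e\<^sub>i\<^sub>+\<^sub>2\<close> are swapped up to a
  scalar) and cancel against those that arise from the main term.\<close>
lemma lift_square:
  assumes "x \<in> M" "t \<le> m" "0 < j" "j \<le> m"
  shows "L (L (cons t x) j) j = scw square_const (cons t x)"
proof (cases j t rule: letter_position_cases)
  case 1
  with assms show ?thesis
    by (simp add: lift_rules gen_square cons_scl power_add[symmetric] mult_2[symmetric])
next
  case 2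
  with assms show ?thesis
    by (cases t) (simp_all add: lift_rules)
next
  case 3
  with assms show ?thesis by (simp add: lift_rules)
next
  case (4 i)
  with assms show ?thesis
    by (cases "even m"; cases "even t"; cases "even i")
      (simp_all add: lift_rules gen_square gen_mem linear_rules desc_Suc
        minus_one_power_iff)
qed

text \<open>The substantial case has both letters beyond \<open>t+1\<close>, say \<open>h+2\<close> and \<open>i+2\<close> with \<open>h+1 < i\<close>. The
  corrections of the larger letter then carry the coefficients \<open>R\<^sub>i \<dots> R\<^sub>t\<^sub>+\<^sub>1\<close> and
  \<open>R\<^sub>i\<^sub>+\<^sub>1 \<dots> R\<^sub>t\<^sub>+\<^sub>1\<close>, which have to be multiplied by \<open>R\<^sub>h\<^sub>+\<^sub>2\<close>: this is \<open>word_desc_gen\<close> in \<open>M\<close>.\<close>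
lemma lift_swap:
  assumes "x \<in> M" "t \<le> m" "0 < k" "Suc k < j" "j \<le> m"
  shows "L (L (cons t x) k) j = - L (L (cons t x) j) k"
proof (cases j t rule: letter_position_cases)
  case 1
  with assms show ?thesis
    by (simp add: lift_rules gen_swap linear_rules)
next
  case 2
  with assms show ?thesis
    by (cases t) (simp_all add: lift_rules)
next
  case 3
  with assms show ?thesis by (simp add: lift_rules linear_rules mult_ac)
next
  case (4 i)
  show ?thesis
  proof (cases k t rule: letter_position_cases)
    case 1
    show ?thesis
      using assms 1 4
      by (cases "even m"; cases "even t"; cases "even i")
        (simp_all add: lift_rules gen_swap word_desc_far linear_rules mult_ac minus_one_power_iff)
  next
    case 2
    then obtain t' where "t = Suc t'" using assms by (cases t) auto
    then show ?thesis
      using assms 2 4 desc_snoc[of t' i] desc_snoc[of t' "Suc i"]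
    by (cases "even m"; cases "even t'"; cases "even i")
      (simp_all add: lift_rules linear_rules mult_ac minus_one_power_iff)
  next
    case 3
    have sq: "r (foldl r x (desc p t)) (Suc t) = scl square_const (foldl r x (desc p (Suc t)))"
       if "t < p" "p < m" for p
    proof -
      have "foldl r x (desc p (Suc t)) \<in> M"
        using assms that by (intro word_mem) auto
      then show ?thesis
        using desc_snoc[of t p] that by (simp add: gen_square)
    qed
    have "t < i" "Suc (Suc i) \<le> m" "t \<le> m"
      using assms 3 4 by auto
    then show ?thesis
      unfolding 3 4(1)
      by (cases "even m"; cases "even t"; cases "even i")
      (simp_all add: lift_rules sq linear_rules mult_ac minus_one_power_iff)
  next
    case (4 h)
    then have "Suc h < i" "Suc (Suc i) \<le> m"
      using assms \<open>j = Suc (Suc i)\<close> by auto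
    \<comment> \<open>The two actions are expanded before the resulting products in \<open>M\<close> are sorted.\<close>
    with assms(1) 4(2) show ?thesis
      unfolding 4(1) \<open>j = Suc (Suc i)\<close>
      by (cases "even m"; cases "even t"; cases "even i"; cases "even h")
        (simp_all add: lift_rules, simp_all add: word_desc_gen gen_swap,
          simp_all add: word_desc_far mult_ac minus_one_power_iff, simp_all add: linear_rules mult_ac)
  qed
qed

text \<open>If both letters lie beyond \<open>t+1\<close>, the first of them being \<open>i+2\<close>, then \<open>R\<^sub>i\<^sub>+\<^sub>1\<close> and \<open>R\<^sub>i\<^sub>+\<^sub>2\<close>
  act on the component of \<open>e\<^sub>t\<close> and the braid relation of \<open>M\<close> is needed for these two. If \<open>t\<close> is
  at the letters, the term \<open>\<epsilon>\<^sup>2\<close> of the relation is produced by the corrections.\<close>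
lemma lift_braid:
  assumes "x \<in> M" "t \<le> m" "0 < k" "Suc k \<le> m"
  shows "L (L (L (cons t x) k) (Suc k)) k - L (L (L (cons t x) (Suc k)) k) (Suc k)
    = scw (eps ^ 2) (L (cons t x) (Suc k) - L (cons t x) k)"
proof -
  consider "Suc k < t" | "Suc k = t" | "k = t" | "k = Suc t" | i where "k = Suc (Suc i)" "t \<le> i"
    by (cases k t rule: letter_position_cases) (use Suc_lessI in blast)+
  then show ?thesis
  proof cases
    case 1
    have braid: "r (r (r x k) (Suc k)) k
        = r (r (r x (Suc k)) k) (Suc k) + scl (eps ^ 2) (r x (Suc k) - r x k)"
      using gen_braid[of x k] assms 1 by (simp add: diff_eq_eq add.commute)
    with assms 1 show ?thesis
      by (cases "even m"; cases "even t")
        (simp_all add: lift_rules braid linear_rules mult_ac minus_one_power_iff)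
  next
    case 2
    then obtain i where i: "k = Suc i" "t = Suc (Suc i)" using assms by (cases k) auto
    show ?thesis
      using assms unfolding i
      by (cases "even m"; cases "even i")
        (simp_all add: lift_rules gen_square linear_rules mult_ac minus_one_power_iff desc_Suc)
  next
    case 3
    then obtain i where i: "k = Suc i" "t = Suc i" using assms by (cases k) auto
    show ?thesis
      using assms unfolding i
      by (cases "even m"; cases "even i")
        (simp_all add: lift_rules gen_square linear_rules mult_ac minus_one_power_iff desc_Suc)
  next
    case 4
    with assms show ?thesis
      by (cases "even m"; cases "even t")
        (simp_all add: lift_rules gen_square linear_rules mult_ac minus_one_power_iff desc_Suc)
  next
    case (5 i)
    have braid: "r (r (r y (Suc i)) (Suc (Suc i))) (Suc i)
        = r (r (r y (Suc (Suc i))) (Suc i)) (Suc (Suc i))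
          + scl (eps ^ 2) (r y (Suc (Suc i)) - r y (Suc i))"
      if "y \<in> M" for y
      using gen_braid[OF that, of "Suc i"] assms 5 by (simp add: diff_eq_eq add.commute)
    \<comment> \<open>The relations of \<open>M\<close> are needed twice, since a first pass exposes new instances of the
        braid and the square relation inside the coefficients.\<close>
    show ?thesis
      using assms 5(2) unfolding 5(1)
      by (cases "even m"; cases "even t"; cases "even i")
        (simp_all add: lift_rules desc_Suc,
          simp_all add: word_desc_far gen_mem minus_one_power_iff,
          simp_all add: braid gen_square gen_mem, simp_all add: linear_rules mult_ac,
          simp_all add: braid gen_square gen_mem, simp_all add: linear_rules mult_ac,
          simp_all add: word_desc_far gen_mem minus_one_power_iff,
          simp_all add: gen_square linear_rules mult_ac)
  qed
qed

end

section \<open>A tower of modules\<close>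

text \<open>One type that serves at every level of the tower: a function on lists, read as a family
  indexed by the head of functions on the tails.\<close>
type_synonym listfun = "nat list \<Rightarrow> ratfun"

definition vscale :: "ratfun \<Rightarrow> listfun \<Rightarrow> listfun" where
  "vscale a x = (\<lambda>l. a * x l)"

lemma vscale_apply: "vscale a x l = a * x l"
  by (simp add: vscale_def)

lemma vector_space_vscale: "vector_space vscale"
  by unfold_locales (simp_all add: vscale_def fun_eq_iff algebra_simps)

definition cons_vec :: "nat \<Rightarrow> listfun \<Rightarrow> listfun" where
  "cons_vec t x = (\<lambda>l. case l of [] \<Rightarrow> 0 | b # k \<Rightarrow> if b = t then x k else 0)"

definition slice :: "nat \<Rightarrow> listfun \<Rightarrow> listfun" where
  "slice t f = (\<lambda>k. f (t # k))"

lemma slice_simps: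
  "slice t (f + g) = slice t f + slice t g" "slice t (vscale a f) = vscale a (slice t f)"
  "slice t 0 = 0"
  by (simp_all add: slice_def vscale_def fun_eq_iff)

lemma slice_cons_vec: "slice s (cons_vec t x) = (if s = t then x else 0)"
  by (simp add: slice_def cons_vec_def fun_eq_iff)

lemma cons_vec_simps:
  "cons_vec t (x + y) = cons_vec t x + cons_vec t y"
  "cons_vec t (vscale a x) = vscale a (cons_vec t x)"
  "cons_vec t (x - y) = cons_vec t x - cons_vec t y"
  "cons_vec t (- x) = - cons_vec t x"
  "cons_vec t 0 = 0"
  by (simp_all add: cons_vec_def vscale_def fun_eq_iff split: list.split)

lemma cons_vec_apply: "cons_vec t x [] = 0" "cons_vec t x (b # k) = (if b = t then x k else 0)"
  by (simp_all add: cons_vec_def)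

definition move_vec :: "nat \<Rightarrow> (listfun \<Rightarrow> nat \<Rightarrow> listfun) \<Rightarrow> nat \<Rightarrow> nat \<Rightarrow> listfun \<Rightarrow> listfun" where
  "move_vec m r t j x =
     (if j < t then vscale ((- 1) ^ (m + t)) (cons_vec t (r x j))
      else if j = t then cons_vec (t - 1) x
      else if j = Suc t then vscale square_const (cons_vec j x)
      else let i = j - 2 in
        vscale ((- 1) ^ (m + t)) (cons_vec t (r x (Suc i)))
        + vscale (- (eps ^ 2) * (- 1) ^ ((m + i) * (i + t))) (cons_vec (Suc i) (foldl r x (desc i t)))
        + vscale (eps ^ 2 * (- 1) ^ (m + t + (m + i) * (i + t)))
            (cons_vec j (foldl r x (desc (Suc i) t))))"

definition lift_op :: "nat \<Rightarrow> (listfun \<Rightarrow> nat \<Rightarrow> listfun) \<Rightarrow> listfun \<Rightarrow> nat \<Rightarrow> listfun" where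
  "lift_op m r f j = (\<Sum>t\<le>m. move_vec m r t j (slice t f))"

text \<open>The sum over \<open>t \<le> m\<close> forgets the value at the empty list and all slices beyond \<open>m\<close>, so the
  square relation can hold only where these vanish.\<close>
definition lift_carrier :: "nat \<Rightarrow> listfun set \<Rightarrow> listfun set" where
  "lift_carrier m M = {f. f [] = 0 \<and> (\<forall>t\<le>m. slice t f \<in> M) \<and> (\<forall>t>m. slice t f = 0)}"

locale spin_module_vec = spin_module vscale m M r for m M r
begin

lemma move_vec_add: "move_vec m r t j (x + y) = move_vec m r t j x + move_vec m r t j y"
  by (cases j t rule: letter_position_cases)
    (simp_all add: move_vec_def gen_add word_add cons_vec_simps scale_right_distrib add_ac)

lemma move_vec_scl: "move_vec m r t j (vscale a x) = vscale a (move_vec m r t j x)"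
  by (cases j t rule: letter_position_cases)
    (simp_all add: move_vec_def gen_scl word_scl cons_vec_simps scale_right_distrib
      scale_right_diff_distrib mult_ac)

lemma move_vec_zero: "move_vec m r t j 0 = 0"
  using move_vec_scl[of t j 0 0] by simp

lemma lift_op_add: "lift_op m r (f + g) j = lift_op m r f j + lift_op m r g j"
  by (simp only: lift_op_def slice_simps move_vec_add sum.distrib)

lemma lift_op_vscale: "lift_op m r (vscale a f) j = vscale a (lift_op m r f j)"
  by (simp only: lift_op_def slice_simps move_vec_scl scale_sum_right)

lemma lift_op_cons: "t \<le> m \<Longrightarrow> lift_op m r (cons_vec t x) j = move_vec m r t j x"
proof -
  assume "t \<le> m"
  have "lift_op m r (cons_vec t x) j = (\<Sum>s\<le>m. if s = t then move_vec m r t j x else 0)"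
    unfolding lift_op_def by (intro sum.cong) (simp_all add: slice_cons_vec move_vec_zero)
  with \<open>t \<le> m\<close> show ?thesis by simp
qed

sublocale spin_lift vscale m M r vscale cons_vec "lift_op m r"
proof (intro spin_lift.intro spin_lift_axioms.intro)
  show "spin_module vscale m M r" by (rule spin_module_axioms)
  show "vector_space vscale" by (rule vector_space_vscale)
qed (simp_all only: lift_op_add lift_op_vscale cons_vec_simps, simp_all add: lift_op_cons move_vec_def)

lemma mem_lift_carrier_decompose:
  assumes "f \<in> lift_carrier m M"
  shows "f = (\<Sum>t\<le>m. cons_vec t (slice t f))"
proof
  fix l
  have eval: "(\<Sum>t\<in>T. F t) l = (\<Sum>t\<in>T. F t l)" for F :: "nat \<Rightarrow> listfun" and T l
    by (induct T rule: infinite_finite_induct) auto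
  show "f l = (\<Sum>t\<le>m. cons_vec t (slice t f)) l"
  proof (cases l)
    case Nil
    with assms show ?thesis by (simp add: eval cons_vec_apply lift_carrier_def)
  next
    case (Cons b k)
    have "f (b # k) = 0" if "\<not> b \<le> m"
    proof -
      have "slice b f k = 0" using assms that by (simp add: lift_carrier_def)
      then show ?thesis by (simp add: slice_def)
    qed
    with Cons show ?thesis by (simp add: eval cons_vec_apply slice_def)
  qed
qed

lemma cons_vec_mem: "t \<le> m \<Longrightarrow> x \<in> M \<Longrightarrow> cons_vec t x \<in> lift_carrier m M"
  by (simp add: lift_carrier_def slice_cons_vec zero_mem) (simp add: cons_vec_def)

lemma lift_carrier_closed:
  "0 \<in> lift_carrier m M"
  "f \<in> lift_carrier m M \<Longrightarrow> g \<in> lift_carrier m M \<Longrightarrow> f + g \<in> lift_carrier m M"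
  "f \<in> lift_carrier m M \<Longrightarrow> vscale a f \<in> lift_carrier m M"
  by (simp_all add: lift_carrier_def slice_simps zero_mem add_mem scl_mem) (simp_all add: vscale_def)

lemma lift_carrier_induct [consumes 1, case_names zero add cons]:
  assumes "f \<in> lift_carrier m M"
    and "P 0" "\<And>f g. P f \<Longrightarrow> P g \<Longrightarrow> P (f + g)"
    and "\<And>t x. t \<le> m \<Longrightarrow> x \<in> M \<Longrightarrow> P (cons_vec t x)"
  shows "P f"
proof -
  have "P (\<Sum>t\<in>T. cons_vec t (slice t f))" if "finite T" "T \<subseteq> {..m}" for T
    using that assms(1)
    by (induct T) (auto simp: lift_carrier_def intro!: assms(2-4))
  from this[of "{..m}"] show ?thesis
    using mem_lift_carrier_decompose[OF assms(1)] by simp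
qed

lemma lift_zero: "lift_op m r 0 j = 0"
  using lift_op_vscale[of 0 0 j] by simp

lemma lift_mem:
  assumes "f \<in> lift_carrier m M" "0 < j" "j \<le> m"
  shows "lift_op m r f j \<in> lift_carrier m M"
proof (rule lift_carrier_induct[OF assms(1)])
  fix t x assume x: "t \<le> m" "x \<in> M"
  note closed = lift_carrier_closed cons_vec_mem word_mem gen_mem
  show "lift_op m r (cons_vec t x) j \<in> lift_carrier m M"
  proof (cases j t rule: letter_position_cases)
    case 1
    with x assms show ?thesis by (simp only: lift_above) (intro closed; simp)
  next
    case 2
    with x assms show ?thesis by (cases t) (simp_all add: lift_down cons_vec_mem)
  next
    case 3
    with x assms show ?thesis by (simp only: lift_up) (intro closed; simp)
  next
    case (4 i)
    with x assms show ?thesis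
      unfolding 4(1) lift_below[OF x(1) 4(2)] by (intro closed) auto
  qed
qed (simp_all only: lift_zero lift_op_add lift_carrier_closed)

lemma lift_spin_module: "spin_module vscale (Suc m) (lift_carrier m M) (lift_op m r)"
proof (intro spin_module.intro spin_module_axioms.intro)
  fix f i j assume f: "f \<in> lift_carrier m M" "0 < j" "j < Suc m"
  let ?P = "\<lambda>f. lift_op m r (lift_op m r f j) j = vscale square_const f"
  show "?P f"
  proof (rule lift_carrier_induct[OF f(1), of ?P])
    fix g h assume "?P g" "?P h"
    then show "?P (g + h)" by (simp only: lift_op_add scale_right_distrib)
  next
    fix t x assume "t \<le> m" "x \<in> M"
    with f show "?P (cons_vec t x)" by (intro lift_square) auto
  qed (simp only: lift_zero scale_zero_right)
next
  fix f i j assume f: "f \<in> lift_carrier m M" "0 < i" "Suc i < j" "j < Suc m"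
  let ?P = "\<lambda>f. lift_op m r (lift_op m r f i) j = - lift_op m r (lift_op m r f j) i"
  show "?P f"
  proof (rule lift_carrier_induct[OF f(1), of ?P])
    fix g h assume "?P g" "?P h"
    then show "?P (g + h)" by (simp only: lift_op_add minus_add_distrib)
  next
    fix t x assume "t \<le> m" "x \<in> M"
    with f show "?P (cons_vec t x)" by (intro lift_swap) auto
  qed (simp only: lift_zero minus_zero)
next
  fix f i assume f: "f \<in> lift_carrier m M" "0 < i" "Suc i < Suc m"
  let ?L = "lift_op m r"
  let ?P = "\<lambda>f. ?L (?L (?L f i) (Suc i)) i - ?L (?L (?L f (Suc i)) i) (Suc i) =
           vscale (eps\<^sup>2) (?L f (Suc i) - ?L f i)"
  show "?P f"
  proof (rule lift_carrier_induct[OF f(1), of ?P])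
    fix g h assume "?P g" "?P h"
    then show "?P (g + h)"
      by (simp only: lift_op_add scale_right_distrib add_diff_add)
  next
    fix t x assume "t \<le> m" "x \<in> M"
    with f show "?P (cons_vec t x)" by (intro lift_braid) auto
  qed (simp only: lift_zero scale_zero_right diff_self)
qed (simp_all only: lift_op_add lift_op_vscale lift_carrier_closed lift_mem less_Suc_eq_le
  vector_space_vscale)

end

fun tower_op :: "nat \<Rightarrow> listfun \<Rightarrow> nat \<Rightarrow> listfun" where
  "tower_op 0 = (\<lambda>x j. 0)"
| "tower_op (Suc m) = lift_op m (tower_op m)"

fun tower_carrier :: "nat \<Rightarrow> listfun set" where
  "tower_carrier 0 = {x. \<forall>l. l \<noteq> [] \<longrightarrow> x l = 0}"
| "tower_carrier (Suc m) = lift_carrier m (tower_carrier m)"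

lemma tower_spin_module: "spin_module vscale m (tower_carrier m) (tower_op m)"
proof (induction m)
  case 0
  show ?case
    by (intro spin_module.intro spin_module_axioms.intro vector_space_vscale)
      (simp_all add: vscale_def fun_eq_iff)
next
  case (Suc m)
  then interpret spin_module_vec m "tower_carrier m" "tower_op m"
    by (rule spin_module_vec.intro)
  show ?case using lift_spin_module by simp
qed

definition delta_vec :: "nat list \<Rightarrow> listfun" where
  "delta_vec l = (\<lambda>k. if k = l then 1 else 0)"

lemma cons_delta_vec: "cons_vec t (delta_vec l) = delta_vec (t # l)"
  by (auto simp: cons_vec_def delta_vec_def fun_eq_iff split: list.split)

definition std_word :: "nat \<Rightarrow> (nat \<Rightarrow> nat) \<Rightarrow> nat list" where
  "std_word n a = concat (map (\<lambda>i. desc i (i - a i)) [1..<n])"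

lemma std_word_Suc: "std_word (Suc n) a = std_word n a @ desc n (n - a n)"
  by (cases "n = 0") (simp_all add: std_word_def)

lemma set_std_word: "set (std_word n a) \<subseteq> {1..<n}"
  by (auto simp: std_word_def)

text \<open>The list \<open>[n-1, \<dots>, 0]\<close> stands for \<open>1\<close>, because \<open>e\<^sub>m\<close> is the empty product at level \<open>m\<close>. On
  the copy \<open>M e\<^sub>m\<close> the generators below \<open>R\<^sub>m\<close> act as on \<open>M\<close> without sign, and \<open>R\<^sub>m, R\<^sub>m\<^sub>-\<^sub>1, \<dots>\<close> then
  move \<open>e\<^sub>m\<close> down step by step.\<close>
lemma tower_std_word:
  "foldl (tower_op n) (delta_vec (rev [0..<n])) (std_word n a)
    = delta_vec (rev (map (\<lambda>i. i - a i) [0..<n]))"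
proof (induction n)
  case 0
  show ?case by (simp add: std_word_def)
next
  case (Suc m)
  interpret spin_module_vec m "tower_carrier m" "tower_op m"
    by (rule spin_module_vec.intro) (rule tower_spin_module)
  have top: "foldl (lift_op m (tower_op m)) (cons_vec m x) w = cons_vec m (foldl (tower_op m) x w)"
    if "set w \<subseteq> {1..<m}" for x w
    using that
  proof (induct w arbitrary: x)
    case (Cons j w)
    then have "lift_op m (tower_op m) (cons_vec m x) j = cons_vec m (tower_op m x j)"
      by (simp add: lift_above mult_2[symmetric])
    with Cons show ?case by simp
  qed simp
  have down: "foldl (lift_op m (tower_op m)) (cons_vec m x) (desc m t) = cons_vec t x"
    if "t \<le> m" for t x
    using that
  proof (induct rule: inc_induct)
    case (step t)
    then show ?case by (simp add: desc_snoc lift_down)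
  qed simp
  show ?case
    using Suc.IH set_std_word[of m a]
    by (simp add: std_word_Suc cons_delta_vec[symmetric] top down)
qed

section \<open>Spanning\<close>
lemma free_const_simps:
  "free_const (a + b) = free_const a + free_const b" "free_const (a * b) = free_const a * free_const b"
  "free_const 1 = 1"
  by (simp_all add: free_const_def single_add mult_single)

interpretation W: vector_space "\<lambda>c f. free_const c * f"
  by unfold_locales (simp_all add: free_const_simps algebra_simps)

lemma free_const_wterm [simp]: "free_const c * wterm a w = wterm (c * a) w"
  using wterm_mult[of "[]" c w a] by (simp add: free_const_def zero_word_def)

text \<open>Combinations of the standard words in the letters below \<open>k\<close>, modulo the relations between
  all generators. Including the ideal makes this a subspace of the free algebra that is closed
  under congruence.\<close>
definition std_span :: "nat \<Rightarrow> nat \<Rightarrow> (word \<Rightarrow>\<^sub>0 ratfun) set" where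
  "std_span n k = W.span (spin_ideal n \<union> (\<lambda>a. wterm 1 (std_word k a)) ` std_exponents k)"

lemma std_span_closed:
  "f \<in> std_span n k \<Longrightarrow> g \<in> std_span n k \<Longrightarrow> f + g \<in> std_span n k"
  "f \<in> std_span n k \<Longrightarrow> free_const c * f \<in> std_span n k"
  "f \<in> spin_ideal n \<Longrightarrow> f \<in> std_span n k"
  by (simp_all add: std_span_def W.span_add W.span_scale W.span_base)

lemma std_span_cong: "spin_cong n f g \<Longrightarrow> g \<in> std_span n k \<Longrightarrow> f \<in> std_span n k"
  using std_span_closed(1)[OF std_span_closed(3), of "f - g" n g k] by (simp add: spin_cong_def)

lemma std_span_induct [consumes 1, case_names ideal word add scale]:
  assumes "f \<in> std_span n k"
    and "\<And>f. f \<in> spin_ideal n \<Longrightarrow> P f"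
    and "\<And>a. a \<in> std_exponents k \<Longrightarrow> P (wterm 1 (std_word k a))"
    and "\<And>f g. P f \<Longrightarrow> P g \<Longrightarrow> P (f + g)"
    and "\<And>c f. P f \<Longrightarrow> P (free_const c * f)"
  shows "P f"
  using assms(1) unfolding std_span_def
proof (induction rule: W.span_induct_alt)
  case base
  show ?case by (rule assms(2)[OF spin_ideal_zero])
next
  case (step c x y)
  then have "P x" using assms(2,3) by blast
  then show ?case by (intro assms(4,5) step)
qed

lemma std_span_mult_word:
  assumes "f \<in> std_span n k" "set w \<subseteq> {1..<n}"
    and "\<And>a. a \<in> std_exponents k \<Longrightarrow> wterm 1 (std_word k a @ w) \<in> std_span n l"
  shows "f * wterm 1 w \<in> std_span n l"
  using assms(1)
proof (induction rule: std_span_induct)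
  case (ideal f)
  then show ?case
    using assms(2) by (intro std_span_closed(3) spin_ideal_mult wterm_carrier)
next
  case (scale c f)
  then show ?case using std_span_closed(2) by (simp only: mult.assoc)
qed (simp_all add: wterm_mult assms(3) distrib_right std_span_closed)

lemma std_word_cong: "(\<And>i. 0 < i \<Longrightarrow> i < k \<Longrightarrow> a i = b i) \<Longrightarrow> std_word k a = std_word k b"
  unfolding std_word_def by (intro arg_cong[of _ _ concat] map_cong) auto

text \<open>Appending the descending word of \<open>R\<^sub>k\<close> turns a standard word of level \<open>k\<close> into one of level
  \<open>k + 1\<close>. For \<open>k = 0\<close> the exponent function must not be changed at \<open>0\<close>, which lies outside its
  domain.\<close>
lemma std_span_mult_desc:
  assumes "f \<in> std_span n k" "0 < k" "k < n" "t \<le> k"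
  shows "f * wterm 1 (desc k t) \<in> std_span n (Suc k)"
proof (rule std_span_mult_word[OF assms(1)])
  show "set (desc k t) \<subseteq> {1..<n}" using assms by auto
  fix a assume a: "a \<in> std_exponents k"
  let ?b = "a(k := k - t)"
  have "?b \<in> std_exponents (Suc k)"
    using a assms(2) by (auto simp: std_exponents_def PiE_iff extensional_def)
  moreover have "std_word (Suc k) ?b = std_word k a @ desc k t"
    using std_word_cong[of k ?b a] assms(4) by (simp add: std_word_Suc)
  ultimately have "wterm 1 (std_word k a @ desc k t)
      \<in> (\<lambda>a. wterm 1 (std_word (Suc k) a)) ` std_exponents (Suc k)"
    by (intro image_eqI[of _ _ ?b]) simp_all
  then show "wterm 1 (std_word k a @ desc k t) \<in> std_span n (Suc k)"
    unfolding std_span_def by (intro W.span_base) blast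
qed

lemma std_span_mult_letters:
  assumes "f \<in> std_span n k" "set w \<subseteq> {1..<k}"
    and "\<And>f j. f \<in> std_span n k \<Longrightarrow> 0 < j \<Longrightarrow> j < k \<Longrightarrow> f * wterm 1 [j] \<in> std_span n k"
  shows "f * wterm 1 w \<in> std_span n k"
  using assms(2)
proof (induction w rule: rev_induct)
  case Nil
  then show ?case using assms(1) by (simp add: zero_word_def[symmetric])
next
  case (snoc j w)
  then have "f * wterm 1 w * wterm 1 [j] \<in> std_span n k"
    by (intro assms(3)) auto
  then show ?case by (simp add: mult.assoc wterm_mult)
qed

text \<open>A standard word of level \<open>k + 1\<close> is \<open>v\<close> followed by \<open>R\<^sub>k \<dots> R\<^sub>t\<^sub>+\<^sub>1\<close> with \<open>v\<close> of level \<open>k\<close>. The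
  product of the descending word with \<open>R\<^sub>j\<close> is a combination of words in the letters below \<open>k\<close>, each
  followed by a descending word, and by induction these letters are absorbed by \<open>v\<close>.\<close>
lemma std_span_mult_gen:
  assumes "0 < k" "k \<le> n" "f \<in> std_span n k" "0 < j" "j < k"
  shows "f * wterm 1 [j] \<in> std_span n k"
  using assms
proof (induction k arbitrary: f j rule: nat_induct_non_zero)
  case 1
  then have False by linarith
  then show ?case ..
next
  case (Suc k)
  have step: "wterm c (v @ w @ desc k s) \<in> std_span n (Suc k)"
    if "wterm 1 v \<in> std_span n k" "set w \<subseteq> {1..<k}" "s \<le> k" for v w c s
  proof -
    have "wterm 1 v * wterm 1 w \<in> std_span n k"
    proof (rule std_span_mult_letters[OF that(1,2)])
      fix f j assume "f \<in> std_span n k" "0 < j" "j < k"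
      moreover have "k \<le> n" using Suc.prems(1) by simp
      ultimately show "f * wterm 1 [j] \<in> std_span n k" by (intro Suc.IH)
    qed
    then have "wterm 1 v * wterm 1 w * wterm 1 (desc k s) \<in> std_span n (Suc k)"
      using Suc.hyps Suc.prems(1) that(3) by (intro std_span_mult_desc) simp_all
    from std_span_closed(2)[OF this, of c] show ?thesis
      by (simp add: wterm_mult)
  qed
  show ?case
  proof (rule std_span_mult_word[OF Suc.prems(2)])
    show "set [j] \<subseteq> {1..<n}" using Suc.prems by auto
    fix a assume a: "a \<in> std_exponents (Suc k)"
    define v where "v = std_word k a"
    define t where "t = k - a k"
    have "restrict a {1..<k} \<in> std_exponents k"
      using a by (auto simp: std_exponents_def PiE_iff)
    moreover have "v = std_word k (restrict a {1..<k})"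
      unfolding v_def by (rule std_word_cong) simp
    ultimately have v: "wterm 1 v \<in> std_span n k"
      unfolding std_span_def by (intro W.span_base) blast
    have letters: "set v \<subseteq> {1..<n}"
      using set_std_word[of k a] Suc.prems(1) by (force simp: v_def)
    have t: "t \<le> k" by (simp add: t_def)
    have "wterm 1 (v @ desc k t @ [j]) \<in> std_span n (Suc k)"
    proof (cases j t rule: letter_position_cases)
      case 1
      have "spin_cong n (wterm 1 (v @ desc k t @ [j] @ []))
        (wterm ((- 1) ^ length (desc k t) * 1) (v @ [j] @ desc k t @ []))"
      proof (rule spin_cong_move_letter)
        show "set (v @ [] @ desc k t) \<subseteq> {1..<n}" "j \<in> {1..<n}"
          using letters Suc.prems by auto
        show "\<forall>i\<in>set (desc k t). \<bar>int j - int i\<bar> > 1" using 1 by auto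
      qed
      moreover have "wterm ((- 1) ^ length (desc k t) * 1) (v @ [j] @ desc k t) \<in> std_span n (Suc k)"
        using 1 t Suc.prems by (intro step[OF v]) auto
      ultimately show ?thesis using std_span_cong by simp
    next
      case 2
      then have "desc k t @ [j] = desc k (t - 1)"
        using desc_snoc[of "t - 1" k] t Suc.prems by simp
      then show ?thesis using step[OF v, of "[]" "t - 1" 1] t by simp
    next
      case 3
      then have "desc k t @ [j] = desc k (Suc t) @ [j, j]"
        using desc_snoc[of t k] Suc.prems by simp
      moreover have "spin_cong n (wterm 1 ((v @ desc k (Suc t)) @ [j, j] @ []))
        (wterm (1 * (- (eps ^ 2) - 2)) ((v @ desc k (Suc t)) @ []))"
        using letters Suc.prems by (intro spin_cong_square) auto
      moreover have "wterm (1 * (- (eps ^ 2) - 2)) (v @ [] @ desc k (Suc t)) \<in> std_span n (Suc k)"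
        using 3 Suc.prems by (intro step[OF v]) auto
      ultimately show ?thesis using std_span_cong by simp
    next
      case (4 i)
      have "spin_cong n (wterm 1 v * wterm 1 (desc k t @ [j]) * wterm 1 [])
        (wterm 1 v * (wterm ((- 1) ^ (k + t)) (Suc i # desc k t)
         + wterm (- (eps ^ 2) * (- 1) ^ ((k + i) * (i + t))) (desc i t @ desc k (Suc i))
         + wterm (eps ^ 2 * (- 1) ^ (k + t + (k + i) * (i + t))) (desc (Suc i) t @ desc k j)) * wterm 1 [])"
        unfolding 4(1)
        using 4 Suc.prems letters by (intro spin_cong_context desc_mult_gen) auto
      then have "spin_cong n (wterm 1 (v @ desc k t @ [j]))
        (wterm ((- 1) ^ (k + t)) (v @ [Suc i] @ desc k t)
         + wterm (- (eps ^ 2) * (- 1) ^ ((k + i) * (i + t))) (v @ desc i t @ desc k (Suc i))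
         + wterm (eps ^ 2 * (- 1) ^ (k + t + (k + i) * (i + t))) (v @ desc (Suc i) t @ desc k j))"
        by (simp only: wterm_mult distrib_left distrib_right mult_1_left mult_1_right append_Nil2
            append_Cons append_Nil)
      then show ?thesis
      proof (rule std_span_cong)
        show "wterm ((- 1) ^ (k + t)) (v @ [Suc i] @ desc k t)
         + wterm (- (eps ^ 2) * (- 1) ^ ((k + i) * (i + t))) (v @ desc i t @ desc k (Suc i))
         + wterm (eps ^ 2 * (- 1) ^ (k + t + (k + i) * (i + t))) (v @ desc (Suc i) t @ desc k j)
           \<in> std_span n (Suc k)"
          using 4 t Suc.prems by (intro std_span_closed(1) step[OF v]) auto
      qed
    qed
    then show "wterm 1 (std_word (Suc k) a @ [j]) \<in> std_span n (Suc k)"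
      by (simp add: std_word_Suc v_def t_def)
  qed
qed

lemma free_alg_subset_std_span:
  assumes "0 < n" "f \<in> carrier (free_alg n)"
  shows "f \<in> std_span n n"
proof -
  have one: "wterm 1 [] \<in> std_span n n"
  proof -
    have "(\<lambda>i\<in>{1..<n}. 0) \<in> std_exponents n"
      by (simp add: std_exponents_def)
    moreover have "std_word n (\<lambda>i\<in>{1..<n}. 0) = []"
      by (auto simp: std_word_def)
    ultimately have "wterm 1 [] \<in> (\<lambda>a. wterm 1 (std_word n a)) ` std_exponents n"
      by (intro image_eqI[of _ _ "\<lambda>i\<in>{1..<n}. 0"]) simp_all
    then show ?thesis
      unfolding std_span_def by (intro W.span_base) blast
  qed
  have word: "wterm c w \<in> std_span n n" if "set w \<subseteq> {1..<n}" for c w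
  proof -
    have "wterm 1 [] * wterm 1 w \<in> std_span n n"
      by (rule std_span_mult_letters[OF one that])
        (rule std_span_mult_gen[OF assms(1) order_refl])
    from std_span_closed(2)[OF this, of c] show ?thesis by (simp add: wterm_mult)
  qed
  show ?thesis
    using assms(2)
  proof (induction f rule: update_induct)
    case const
    show ?case by (rule std_span_closed(3)[OF spin_ideal_zero])
  next
    case (update f w c)
    have "Poly_Mapping.keys (Poly_Mapping.update w c f) = insert w (Poly_Mapping.keys f)"
      using update.hyps by (auto simp: in_keys_iff lookup_update split: if_splits)
    then have "set (letters w) \<subseteq> {1..<n}" "f \<in> carrier (free_alg n)"
      using update.prems by (auto simp: free_alg_def)
    then show ?case
      unfolding update_fresh_key[OF update.hyps(1)] by (intro std_span_closed(1) word update.IH)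
  qed
qed

section \<open>The basis of the quotient algebra\<close>
abbreviation coset :: "nat \<Rightarrow> (word \<Rightarrow>\<^sub>0 ratfun) \<Rightarrow> (word \<Rightarrow>\<^sub>0 ratfun) set" where
  "coset n f \<equiv> spin_ideal n +>\<^bsub>free_alg n\<^esub> f"

lemma coset_ring_hom: "coset n \<in> Ring.ring_hom (free_alg n) (spin_hecke n)"
  using ideal.rcos_ring_hom[OF spin_ideal_ideal] by (simp add: Ring.ring_hom_def spin_hecke_sel)

lemma coset_simps:
  assumes "f \<in> carrier (free_alg n)" "g \<in> carrier (free_alg n)"
  shows "coset n (f + g) = coset n f \<oplus>\<^bsub>spin_hecke n\<^esub> coset n g"
    and "coset n (f * g) = coset n f \<otimes>\<^bsub>spin_hecke n\<^esub> coset n g"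
    and "coset n (free_const c * f) = c \<odot>\<^bsub>spin_hecke n\<^esub> coset n f"
  using ring_hom_add[OF coset_ring_hom assms] ring_hom_mult[OF coset_ring_hom assms]
    ring_hom_mult[OF coset_ring_hom free_const_carrier assms(1)]
  by (simp_all add: free_alg_def spin_hecke_sel)

lemma coset_one: "coset n (wterm 1 []) = \<one>\<^bsub>spin_hecke n\<^esub>"
  using ring_hom_one[OF coset_ring_hom, of n] by (simp add: free_alg_def zero_word_def[symmetric])

lemma coset_eq_iff:
  assumes "f \<in> carrier (free_alg n)" "g \<in> carrier (free_alg n)"
  shows "coset n f = coset n g \<longleftrightarrow> spin_cong n f g"
proof -
  interpret I: ideal "spin_ideal n" "free_alg n" by (rule spin_ideal_ideal)
  have minus: "f \<ominus>\<^bsub>free_alg n\<^esub> g = f - g"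
  proof -
    have "\<ominus>\<^bsub>free_alg n\<^esub> g = - g"
      using assms(2) by (intro I.minus_equality) (simp_all add: free_alg_def)
    then show ?thesis by (simp add: a_minus_def free_alg_def)
  qed
  show ?thesis
    using I.quotient_eq_iff_same_a_r_cos[OF spin_ideal_ideal assms] minus by (simp add: spin_cong_def)
qed

lemma coset_zero: "f \<in> spin_ideal n \<Longrightarrow> coset n f = \<zero>\<^bsub>spin_hecke n\<^esub>"
proof -
  interpret I: ideal "spin_ideal n" "free_alg n" by (rule spin_ideal_ideal)
  show "f \<in> spin_ideal n \<Longrightarrow> coset n f = \<zero>\<^bsub>spin_hecke n\<^esub>"
    by (simp add: spin_hecke_sel FactRing_def I.a_rcos_const)
qed

lemma coset_zeroD:
  assumes "coset n f = \<zero>\<^bsub>spin_hecke n\<^esub>" "f \<in> carrier (free_alg n)"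
  shows "f \<in> spin_ideal n"
proof -
  interpret I: ideal "spin_ideal n" "free_alg n" by (rule spin_ideal_ideal)
  show ?thesis
    using assms I.a_rcos_self[OF assms(2)] by (simp add: spin_hecke_sel FactRing_def)
qed

lemma coset_concat:
  assumes "\<And>w. w \<in> set ws \<Longrightarrow> set w \<subseteq> {1..<n}"
  shows "ordered_prod (spin_hecke n) (map (\<lambda>w. coset n (wterm 1 w)) ws) = coset n (wterm 1 (concat ws))"
  using assms
proof (induction ws)
  case Nil
  show ?case by (simp add: ordered_prod_def coset_one)
next
  case (Cons w ws)
  have "wterm 1 w \<in> carrier (free_alg n)" "wterm 1 (concat ws) \<in> carrier (free_alg n)"
    using Cons.prems by (fastforce intro!: wterm_carrier)+
  then have "coset n (wterm 1 w * wterm 1 (concat ws))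
      = coset n (wterm 1 w) \<otimes>\<^bsub>spin_hecke n\<^esub> coset n (wterm 1 (concat ws))"
    by (rule coset_simps)
  then show ?case using Cons by (simp add: ordered_prod_def wterm_mult)
qed

lemma desc_eq_map: "a \<le> i \<Longrightarrow> desc i (i - a) = map (\<lambda>j. i - j) [0..<a]"
  by (rule nth_equalityI) (auto simp: desc_def rev_nth simp del: upt_Suc)

lemma spin_block_eq_coset:
  assumes "a \<le> i" "i < n"
  shows "spin_block n i a = coset n (wterm 1 (desc i (i - a)))"
proof -
  have "spin_block n i a
      = ordered_prod (spin_hecke n) (map (\<lambda>w. coset n (wterm 1 w)) (map (\<lambda>j. [i - j]) [0..<a]))"
    by (simp add: spin_block_def spin_gen_def free_gen_def comp_def)
  also have "\<dots> = coset n (wterm 1 (concat (map (\<lambda>j. [i - j]) [0..<a])))"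
    using assms by (intro coset_concat) auto
  also have "concat (map (\<lambda>j. [i - j]) [0..<a]) = desc i (i - a)"
    using assms(1) by (simp add: desc_eq_map concat_map_singleton)
  finally show ?thesis .
qed

lemma std_monomial_eq_coset:
  assumes "a \<in> std_exponents n"
  shows "std_monomial n a = coset n (wterm 1 (std_word n a))"
proof -
  have "map (\<lambda>i. spin_block n i (a i)) [1..<n]
      = map (\<lambda>w. coset n (wterm 1 w)) (map (\<lambda>i. desc i (i - a i)) [1..<n])"
    using assms by (auto simp: std_exponents_def PiE_iff intro!: spin_block_eq_coset)
  then have "std_monomial n a
      = ordered_prod (spin_hecke n)
          (map (\<lambda>w. coset n (wterm 1 w)) (map (\<lambda>i. desc i (i - a i)) [1..<n]))"
    by (simp only: std_monomial_def)
  also have "\<dots> = coset n (wterm 1 (std_word n a))"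
    unfolding std_word_def by (rule coset_concat) auto
  finally show ?thesis .
qed

lemma std_word_carrier: "wterm c (std_word n a) \<in> carrier (free_alg n)"
  by (rule wterm_carrier[OF set_std_word])

lemma delta_vec_mem: "delta_vec (rev [0..<n]) \<in> tower_carrier n"
proof (induction n)
  case 0
  show ?case by (simp add: delta_vec_def)
next
  case (Suc n)
  interpret spin_module_vec n "tower_carrier n" "tower_op n"
    by (rule spin_module_vec.intro) (rule tower_spin_module)
  show ?case using cons_vec_mem[OF order_refl Suc.IH] by (simp add: cons_delta_vec)
qed

definition std_index :: "nat \<Rightarrow> (nat \<Rightarrow> nat) \<Rightarrow> nat list" where
  "std_index n a = rev (map (\<lambda>i. i - a i) [0..<n])"

lemma inj_std_index: "inj_on (std_index n) (std_exponents n)"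
proof (rule inj_onI)
  fix a b assume ab: "a \<in> std_exponents n" "b \<in> std_exponents n" and "std_index n a = std_index n b"
  then have eq: "i - a i = i - b i" if "i < n" for i
    using that by (auto simp: std_index_def)
  have "a i = b i" if "i \<in> {1..<n}" for i
  proof -
    have "a i \<le> i" "b i \<le> i" using ab that by (auto simp: std_exponents_def PiE_iff)
    then show ?thesis using eq[of i] that by auto
  qed
  then show "a = b"
    using ab unfolding std_exponents_def by (intro PiE_ext) auto
qed

text \<open>A relation between standard words annihilates the vector \<open>[n-1, \<dots>, 0]\<close>, but it sends this
  vector to the same combination of distinct basis vectors.\<close>
lemma std_words_independent:
  assumes "finite X" "X \<subseteq> std_exponents n" "(\<Sum>a\<in>X. wterm (c a) (std_word n a)) \<in> spin_ideal n" "b \<in> X"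
  shows "c b = 0"
proof -
  interpret spin_module vscale n "tower_carrier n" "tower_op n" by (rule tower_spin_module)
  let ?v = "delta_vec (rev [0..<n])"
  have "act (\<Sum>a\<in>X. wterm (c a) (std_word n a)) ?v l = (\<Sum>a\<in>X. c a * delta_vec (std_index n a) l)" for l
    using assms(1)
  proof (induct X)
    case (insert a X)
    have "act (\<Sum>a\<in>insert a X. wterm (c a) (std_word n a)) ?v
        = vscale (c a) (delta_vec (std_index n a)) + act (\<Sum>a\<in>X. wterm (c a) (std_word n a)) ?v"
      unfolding sum.insert[OF insert(1,2)] act_add act_wterm tower_std_word std_index_def ..
    from fun_cong[OF this, of l] show ?case
      unfolding sum.insert[OF insert(1,2)] plus_fun_apply vscale_apply insert(3) .
  qed simp
  then have "(\<Sum>a\<in>X. c a * delta_vec (std_index n a) (std_index n b)) = 0"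
    using fun_cong[OF act_spin_ideal[OF assms(3) delta_vec_mem], of "std_index n b"]
    by (simp only: zero_fun_apply)
  also have "(\<Sum>a\<in>X. c a * delta_vec (std_index n a) (std_index n b)) = (\<Sum>a\<in>X. if a = b then c b else 0)"
  proof (rule sum.cong)
    fix a assume "a \<in> X"
    then have "std_index n b = std_index n a \<longleftrightarrow> a = b"
      using inj_on_eq_iff[OF inj_std_index, of a n b] subsetD[OF assms(2)] assms(4) by auto
    then show "c a * delta_vec (std_index n a) (std_index n b) = (if a = b then c b else 0)"
      by (simp add: delta_vec_def)
  qed simp
  finally show ?thesis using assms(1,4) by simp
qed

text \<open>If two standard monomials coincided, their difference would be a nontrivial relation.\<close>
lemma inj_std_monomial: "inj_on (std_monomial n) (std_exponents n)"
proof (rule inj_onI, rule ccontr)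
  fix a b assume ab: "a \<in> std_exponents n" "b \<in> std_exponents n" "std_monomial n a = std_monomial n b"
    and "a \<noteq> b"
  let ?c = "\<lambda>x. if x = a then 1 else - 1 :: ratfun"
  have "spin_cong n (wterm 1 (std_word n a)) (wterm 1 (std_word n b))"
    using ab by (simp add: std_monomial_eq_coset coset_eq_iff std_word_carrier)
  then have "(\<Sum>x\<in>{a, b}. wterm (?c x) (std_word n x)) \<in> spin_ideal n"
    using \<open>a \<noteq> b\<close> by (simp add: spin_cong_def single_uminus)
  from std_words_independent[OF _ _ this, of a] ab show False by simp
qed

lemma finite_std_exponents: "finite (std_exponents n)"
  unfolding std_exponents_def by (intro finite_PiE) auto

lemma card_std_exponents: "card (std_exponents n) = fact n"
proof -
  have "card (std_exponents n) = (\<Prod>i\<in>{1..<n}. Suc i)"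
    by (simp add: std_exponents_def card_PiE)
  also have "\<dots> = fact n"
    by (induction n) (auto simp: prod.atLeastLessThan_Suc)
  finally show ?thesis .
qed

lemma std_monomial_carrier: "a \<in> std_exponents n \<Longrightarrow> std_monomial n a \<in> carrier (spin_hecke n)"
  using ring_hom_closed[OF coset_ring_hom std_word_carrier] by (simp add: std_monomial_eq_coset)

lemma std_monomial_basis:
  assumes "0 < n"
  shows "vectorspace.basis ratfun_field (spin_hecke n) (std_monomial n ` std_exponents n)"
proof -
  interpret H: vectorspace ratfun_field "spin_hecke n" by (rule spin_hecke_vectorspace)
  let ?B = "std_monomial n ` std_exponents n"
  have B: "?B \<subseteq> carrier (spin_hecke n)" by (auto intro: std_monomial_carrier)
  have "H.lin_indpt ?B"
  proof (rule H.finite_lin_indpt2)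
    show "finite ?B" using finite_std_exponents by blast
    show "?B \<subseteq> carrier (spin_hecke n)" by (rule B)
    fix c assume zero: "H.lincomb c ?B = \<zero>\<^bsub>spin_hecke n\<^esub>"
    let ?s = "\<lambda>X. \<Sum>a\<in>X. wterm (c (std_monomial n a)) (std_word n a)"
    have sum: "H.lincomb c (std_monomial n ` X) = coset n (?s X) \<and> ?s X \<in> carrier (free_alg n)"
      if "finite X" "X \<subseteq> std_exponents n" for X
      using that
    proof (induction X)
      case empty
      then show ?case
        using coset_zero[OF spin_ideal_zero, of n] free_const_carrier[of 0 n]
        by (simp add: H.lincomb_def free_const_def)
    next
      case (insert a X)
      have new: "std_monomial n a \<notin> std_monomial n ` X"
        using insert inj_onD[OF inj_std_monomial, of n a] by blast
      have "wterm (c (std_monomial n a)) (std_word n a)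
          = free_const (c (std_monomial n a)) * wterm 1 (std_word n a)"
        by simp
      then have summand: "coset n (wterm (c (std_monomial n a)) (std_word n a))
          = c (std_monomial n a) \<odot>\<^bsub>spin_hecke n\<^esub> std_monomial n a"
        using coset_simps(3)[OF std_word_carrier std_word_carrier] insert.prems
        by (simp only: std_monomial_eq_coset insert_subset)
      have "H.lincomb c (insert (std_monomial n a) (std_monomial n ` X))
          = (c (std_monomial n a) \<odot>\<^bsub>spin_hecke n\<^esub> std_monomial n a)
            \<oplus>\<^bsub>spin_hecke n\<^esub> H.lincomb c (std_monomial n ` X)"
        unfolding H.lincomb_def using insert new std_monomial_carrier
        by (intro H.finsum_insert) (auto intro!: H.smult_closed simp: subset_iff)
      then show ?case
        using insert coset_simps(1)[OF std_word_carrier[of n a "c (std_monomial n a)"], of "?s X"]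
          free_alg_closed(1)[OF std_word_carrier[of n a "c (std_monomial n a)"], of "?s X"]
        by (simp add: summand)
    qed
    have "?s (std_exponents n) \<in> spin_ideal n"
      using sum[OF finite_std_exponents order_refl] zero coset_zeroD by metis
    from std_words_independent[OF finite_std_exponents order_refl this]
    show "\<forall>v\<in>?B. c v = \<zero>\<^bsub>ratfun_field\<^esub>" by auto
  qed
  moreover have "H.span ?B = carrier (spin_hecke n)"
  proof
    show "H.span ?B \<subseteq> carrier (spin_hecke n)" by (rule H.span_is_subset2[OF B])
    interpret S: submodule ratfun_field "H.span ?B" "spin_hecke n" by (rule H.span_is_submodule[OF B])
    have "f \<in> carrier (free_alg n) \<and> coset n f \<in> H.span ?B" if "f \<in> std_span n n" for f
      using that
    proof (induction rule: std_span_induct)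
      case (ideal f)
      have "f \<in> carrier (free_alg n)"
        using ideal ideal.Icarr[OF spin_ideal_ideal] by blast
      then show ?case using coset_zero[OF ideal] S.zero_closed by simp
    next
      case (word a)
      then show ?case
        using std_word_carrier H.in_own_span[OF B] by (auto simp: std_monomial_eq_coset[symmetric])
    next
      case (add f g)
      then show ?case using free_alg_closed(1)[of f n g] by (simp add: coset_simps S.m_closed)
    next
      case (scale c f)
      then show ?case using free_alg_closed(3)[OF free_const_carrier, of f n c]
        by (simp add: coset_simps S.smult_closed)
    qed
    then have span: "coset n f \<in> H.span ?B" if "f \<in> carrier (free_alg n)" for f
      using free_alg_subset_std_span[OF assms that] by blast
    show "carrier (spin_hecke n) \<subseteq> H.span ?B"
      using span by (auto simp: spin_hecke_sel FactRing_def A_RCOSETS_def')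
  qed
  ultimately show ?thesis using B by (simp add: H.basis_def)
qed

theorem theorem3p9:
  fixes n :: nat
  assumes "n \<ge> 1"
  shows "inj_on (std_monomial n) (std_exponents n) \<and>
         vectorspace.basis ratfun_field (spin_hecke n) (std_monomial n ` std_exponents n) \<and>
         vectorspace.dim ratfun_field (spin_hecke n) = fact n"
proof (intro conjI)
  show inj: "inj_on (std_monomial n) (std_exponents n)" by (rule inj_std_monomial)
  show basis: "vectorspace.basis ratfun_field (spin_hecke n) (std_monomial n ` std_exponents n)"
    using assms by (intro std_monomial_basis) simp
  have "vectorspace.dim ratfun_field (spin_hecke n) = card (std_monomial n ` std_exponents n)"
    using vectorspace.dim_basis[OF spin_hecke_vectorspace _ basis] finite_std_exponents by blast
  then show "vectorspace.dim ratfun_field (spin_hecke n) = fact n"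
    by (simp add: card_image[OF inj] card_std_exponents)
qed

end
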